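(* Let $\rho>1$, let $u\in\mathcal A_\rho$ with $M=\max_{z\in\mathcal E_\rho}|u(z)|$, let $\alpha>-1$ and let $n\ge1$ be an integer. Then the Gegenbauer-Gauss quadrature remainder satisfies $$ \big|E_n^{GG}[u]\big|\le\gamma_n^{\alpha,\alpha}\Big[\big|\mu_{n,0}^{\alpha,\alpha}\big|+\sup_{l\ge0}\big|\mu_{n,2l+2}^{\alpha,\alpha}-\mu_{n,2l}^{\alpha,\alpha}\big|\,\frac{1}{\rho^{2}-1}\Big]\frac{M}{\rho^{2n}}, $$ where $\{\mu_{n,2l}^{\alpha,\alpha}\}_{l\ge0}$ are computed by the recursive formula $$ \mu_{n,0}^{\alpha,\alpha}=\frac{\sigma_{n,0}^{\alpha,\alpha}}{A_n^\alpha g_n^\alpha},\qquad \mu_{n,2l}^{\alpha,\alpha}=\frac{1}{g_n^\alpha}\Big(\frac{\sigma_{n,2l}^{\alpha,\alpha}}{A_n^\alpha}-\sum_{k=1}^{\min\{n,l\}}g_k^\alpha g_{n-k}^{\alpha}\,\mu_{n,2l-2k}^{\alpha,\alpha}\Big),\quad l\ge1. $$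
   Context: For $\rho>1$, the Bernstein ellipse is $\mathcal E_\rho=\{z\in\mathbb C: z=\tfrac12(w+w^{-1}),\ w=\rho e^{\mathrm i\theta},\ \theta\in[0,2\pi]\}$, and $\mathcal A_\rho$ is the set of functions analytic on and within $\mathcal E_\rho$. For $\alpha>-1$, let $\omega^{\alpha,\alpha}(x)=(1-x^2)^\alpha$ on $(-1,1)$, and let $J_n^{\alpha,\alpha}$ be the Jacobi polynomial of degree $n$ with both parameters $\alpha$ in Szegö's normalization: $\omega^{\alpha,\alpha}(x)J_n^{\alpha,\alpha}(x)=\frac{(-1)^n}{2^n n!}\frac{d^n}{dx^n}(1-x^2)^{\alpha+n}$. Put $\gamma_n^{\alpha,\alpha}=\int_{-1}^1(J_n^{\alpha,\alpha})^2\omega^{\alpha,\alpha}\,dx=\frac{2^{2\alpha+1}\Gamma(n+\alpha+1)^2}{(2n+2\alpha+1)\,n!\,\Gamma(n+2\alpha+1)}$. $E_n^{GG}[u]=\int_{-1}^1u(x)\omega^{\alpha,\alpha}(x)\,dx-\sum_{j=1}^nu(x_j)\omega_j$, where $x_1,\dots,x_n$ are the zeros of $J_n^{\alpha,\alpha}$ and $\omega_1,\dots,\omega_n$ are the corresponding Gauss quadrature weights (so the rule is exact for polynomials of degree at most $2n-1$ with weight $\omega^{\alpha,\alpha}$). $\sigma_{n,j}^{\alpha,\alpha}=\frac1{\gamma_n^{\alpha,\alpha}}\int_{-1}^1U_{n+j}(x)J_n^{\alpha,\alpha}(x)\omega^{\alpha,\alpha}(x)\,dx$ for $n,j\ge0$,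 where $U_k$ is the Chebyshev polynomial of the second kind of degree $k$. For $\alpha\ne-1/2$: $g_0^\alpha=1$, $g_k^\alpha=\frac{\Gamma(k+\alpha+1/2)}{k!\,\Gamma(\alpha+1/2)}$ for $1\le k\le n$, and $A_n^\alpha=\frac{\Gamma(2\alpha+1)\Gamma(n+\alpha+1)}{\Gamma(\alpha+1)\Gamma(n+2\alpha+1)}$. For $\alpha=-1/2$: $g_0^{-1/2}=g_n^{-1/2}=1$, $g_k^{-1/2}=0$ for $1\le k\le n-1$, and $A_n^{-1/2}=\frac{\Gamma(n+1/2)}{2\sqrt\pi\,n!}$. *)

theory Defs
  imports "HOL-Complex_Analysis.Complex_Analysis"
begin

definition bernstein_ellipse :: "real \<Rightarrow> complex set" where
  "bernstein_ellipse \<rho> =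
     {z. \<exists>w. (\<exists>\<theta>\<in>{0..2 * pi}. w = of_real \<rho> * exp (\<i> * of_real \<theta>)) \<and> z = (w + inverse w) / 2}"

definition analytic_ellipse :: "real \<Rightarrow> (complex \<Rightarrow> complex) set" where
  "analytic_ellipse \<rho> = {u. u analytic_on (bernstein_ellipse \<rho> \<union> inside (bernstein_ellipse \<rho>))}"

definition gegenbauer_weight :: "real \<Rightarrow> real \<Rightarrow> real" where
  "gegenbauer_weight \<alpha> x = (1 - x\<^sup>2) powr \<alpha>"

(* Rodrigues' formula on (-1,1), where the weight is positive, determines the polynomial uniquely. *)
definition jacobi_poly :: "real \<Rightarrow> nat \<Rightarrow> real poly" where
  "jacobi_poly \<alpha> n = (THE p. \<forall>x\<in>{-1<..<1}.
     gegenbauer_weight \<alpha> x * poly p x =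
       (-1) ^ n / (2 ^ n * fact n) * (deriv ^^ n) (\<lambda>t. (1 - t\<^sup>2) powr (\<alpha> + real n)) x)"

definition jacobi_norm :: "real \<Rightarrow> nat \<Rightarrow> real" where
  "jacobi_norm \<alpha> n = (LBINT x:{-1<..<1}. (poly (jacobi_poly \<alpha> n) x)\<^sup>2 * gegenbauer_weight \<alpha> x)"

definition gauss_nodes :: "real \<Rightarrow> nat \<Rightarrow> real set" where
  "gauss_nodes \<alpha> n = {x. poly (jacobi_poly \<alpha> n) x = 0}"

(* The weight attached to the node x is the integral of the Lagrange basis polynomial of x.
   Exactness up to degree 2n-1 then follows from the orthogonality of the Jacobi polynomials. *)
definition gauss_weight :: "real \<Rightarrow> nat \<Rightarrow> real \<Rightarrow> real" where
  "gauss_weight \<alpha> n x =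
     (LBINT t:{-1<..<1}. (\<Prod>y\<in>gauss_nodes \<alpha> n - {x}. (t - y) / (x - y)) * gegenbauer_weight \<alpha> t)"

definition gauss_remainder :: "real \<Rightarrow> nat \<Rightarrow> (complex \<Rightarrow> complex) \<Rightarrow> complex" where
  "gauss_remainder \<alpha> n u =
     (LBINT x:{-1<..<1}. u (of_real x) * of_real (gegenbauer_weight \<alpha> x))
     - (\<Sum>x\<in>gauss_nodes \<alpha> n. u (of_real x) * of_real (gauss_weight \<alpha> n x))"

fun chebyshev_U :: "nat \<Rightarrow> real poly" where
  "chebyshev_U 0 = 1"
| "chebyshev_U (Suc 0) = [:0, 2:]"
| "chebyshev_U (Suc (Suc k)) = [:0, 2:] * chebyshev_U (Suc k) - chebyshev_U k"

definition gegenbauer_sigma :: "real \<Rightarrow> nat \<Rightarrow> nat \<Rightarrow> real" where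
  "gegenbauer_sigma \<alpha> n j = 1 / jacobi_norm \<alpha> n *
     (LBINT x:{-1<..<1}. poly (chebyshev_U (n + j)) x * poly (jacobi_poly \<alpha> n) x * gegenbauer_weight \<alpha> x)"

(* The value depends on n only when \<alpha> = -1/2. *)
definition gegenbauer_g :: "real \<Rightarrow> nat \<Rightarrow> nat \<Rightarrow> real" where
  "gegenbauer_g \<alpha> n k =
     (if \<alpha> = -1/2 then (if k = 0 \<or> k = n then 1 else 0)
      else if k = 0 then 1
      else Gamma (real k + \<alpha> + 1/2) / (fact k * Gamma (\<alpha> + 1/2)))"

definition gegenbauer_A :: "real \<Rightarrow> nat \<Rightarrow> real" where
  "gegenbauer_A \<alpha> n =
     (if \<alpha> = -1/2 then Gamma (real n + 1/2) / (2 * sqrt pi * fact n)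
      else Gamma (2 * \<alpha> + 1) * Gamma (real n + \<alpha> + 1)
             / (Gamma (\<alpha> + 1) * Gamma (real n + 2 * \<alpha> + 1)))"

(* Only even second indices occur, so the argument l stands for the index 2l. *)
fun gegenbauer_mu :: "real \<Rightarrow> nat \<Rightarrow> nat \<Rightarrow> real" where
  "gegenbauer_mu \<alpha> n l =
     (if l = 0 then gegenbauer_sigma \<alpha> n 0 / (gegenbauer_A \<alpha> n * gegenbauer_g \<alpha> n n)
      else 1 / gegenbauer_g \<alpha> n n *
        (gegenbauer_sigma \<alpha> n (2 * l) / gegenbauer_A \<alpha> n
         - (\<Sum>k=1..min n l. gegenbauer_g \<alpha> n k * gegenbauer_g \<alpha> n (n - k) * gegenbauer_mu \<alpha> n (l - k))))"

declare gegenbauer_mu.simps [simp del]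

end

theory Submission
  imports Defs
begin

text \<open>
  Since the Chebyshev expansion of an analytic function converges geometrically on the interval, the
  remainder is a sum of its values at Chebyshev polynomials, with coefficients bounded by
  \<open>2 M / \<rho>^k\<close>. The point is that \<open>\<gamma> \<mu>\<^sub>2\<^sub>l\<close> is the quadrature remainder of
  \<open>U\<^sub>k\<close> with \<open>k = 2n + 2l\<close>: the cosine expansion of the Jacobi polynomial \<open>J\<close> writes
  \<open>J U\<^sub>n\<^sub>+\<^sub>j\<close> as a combination of such \<open>U\<^sub>k\<close>, and the remainder of a multiple of \<open>J\<close> is a
  bare integral because \<open>J\<close> vanishes at the nodes. This is exactly the recursion for \<open>\<mu>\<close>.
  As \<open>2 T\<^sub>k = U\<^sub>k - U\<^sub>k\<^sub>-\<^sub>2\<close>, the differences of \<open>\<mu>\<close> are, up to the factor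
  \<open>2 / \<gamma>\<close>, the remainders of the \<open>T\<^sub>k\<close>, which also shows that they are bounded.
\<close>

section \<open>The ultraspherical weight and the Rodrigues polynomials\<close>

text \<open>Every fact about the Jacobi polynomial (degree, orthogonality, zeros, cosine
  coefficients) is an induction on the degree that raises the parameter from \<alpha> to \<alpha> +
  1, because one derivative in Rodrigues' formula trades a power of 1 - x^2 for a degree. This also
  tames the exceptional \<alpha> = -1/2, where the Gamma quotients behind
  \<open>gegenbauer_A\<close> and \<open>gegenbauer_g\<close> meet a pole: it can only stand at the
  last step, whose predecessor 1/2 is regular. The recursion for \<mu> is a triangular linear
  system, cut at min n l because the rule is exact below degree 2n. By parity the same system makes
  all odd remainders vanish, so the expansion advances in steps of \<rho>^-2 and the geometric
  series gives 1 / (\<rho>^2 - 1). The 2 in the coefficient bound cancels against the 1/2 in T_k =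
  (U_k - U_{k-2}) / 2. The expansion is never summed: each truncation carries an explicit error,
  from a geometric expansion of the Cauchy kernel pulled back to a circle by the Joukowski map, and
  the limit for u is taken only in the final inequality.\<close>

lemma poly_eq_on_interval:
  fixes p q :: "real poly"
  assumes "\<And>x. x \<in> {-1<..<1} \<Longrightarrow> poly p x = poly q x"
  shows "p = q"
proof -
  have "infinite {-1<..<1::real}" by simp
  moreover have "{-1<..<1} \<subseteq> {x. poly (p - q) x = 0}" using assms by auto
  ultimately have "infinite {x. poly (p - q) x = 0}" using finite_subset by blast
  then have "p - q = 0" using poly_roots_finite by blast
  then show ?thesis by simp
qed

section \<open>Positivity and integrability of the weight\<close>

lemma one_minus_square_pos: "x \<in> {-1<..<1} \<Longrightarrow> 0 < 1 - (x::real)\<^sup>2"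
  by (simp add: abs_square_less_1 abs_less_iff)

lemma gegenbauer_weight_pos: "x \<in> {-1<..<1} \<Longrightarrow> 0 < gegenbauer_weight \<alpha> x"
  using one_minus_square_pos[of x] by (simp add: gegenbauer_weight_def)

lemma gegenbauer_weight_Suc:
  "x \<in> {-1<..<1} \<Longrightarrow> gegenbauer_weight (\<alpha> + 1) x = (1 - x\<^sup>2) * gegenbauer_weight \<alpha> x"
  using one_minus_square_pos[of x] by (simp add: gegenbauer_weight_def powr_add)

text \<open>With t = (x + 1) / 2 the weight becomes 4^\<alpha> t^\<alpha> (1 - t)^\<alpha>, a Beta
  integrand with both parameters \<alpha> + 1 > 0. Nonnegativity upgrades Henstock-Kurzweil to
  absolute integrability.\<close>

lemma set_integrable_gegenbauer_weight:
  assumes "\<alpha> > -1"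
  shows "set_integrable lborel {-1<..<1} (gegenbauer_weight \<alpha>)"
proof -
  have "(\<lambda>t. t powr (\<alpha> + 1 - 1) * (1 - t) powr (\<alpha> + 1 - 1)) integrable_on {0..1}"
    using has_integral_Beta_real[of "\<alpha> + 1" "\<alpha> + 1"] assms by (auto simp: integrable_on_def)
  then obtain I where "((\<lambda>t. t powr \<alpha> * (1 - t) powr \<alpha>) has_integral I) {0..1}"
    by (auto simp: integrable_on_def)
  then have "((\<lambda>t. t powr \<alpha> * (1 - t) powr \<alpha>) has_integral I) (cbox 0 (1::real))"
    by simp
  have im: "(\<lambda>x. 2 * x - 1) ` {0..1} = {-1..1::real}"
  proof -
    have "x \<in> (\<lambda>x. 2 * x - 1) ` {0..1}" if "x \<in> {-1..1}" for x :: real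
      by (rule image_eqI[of _ _ "(x + 1) / 2"]) (use that in \<open>auto simp: field_simps\<close>)
    then show ?thesis by auto
  qed
  from has_integral_affinity[OF \<open>(_ has_integral I) (cbox 0 1)\<close>, of "1/2" "1/2"] im
  have "(\<lambda>x. (x/2 + 1/2) powr \<alpha> * (1 - (x/2 + 1/2)) powr \<alpha>) integrable_on {-1..1}"
    by (auto simp: integrable_on_def)
  then have "(\<lambda>x. 4 powr \<alpha> * ((x/2 + 1/2) powr \<alpha> * (1 - (x/2 + 1/2)) powr \<alpha>)) integrable_on {-1..1}"
    using integrable_cmul[of _ _ "4 powr \<alpha>"] by simp
  then have "gegenbauer_weight \<alpha> integrable_on {-1..1}"
  proof (rule integrable_eq)
    fix x :: real assume "x \<in> {-1..1}"
    then have "4 powr \<alpha> * ((x/2 + 1/2) powr \<alpha> * (1 - (x/2 + 1/2)) powr \<alpha>)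
        = (4 * ((x/2 + 1/2) * (1 - (x/2 + 1/2)))) powr \<alpha>"
      by (simp add: powr_mult)
    also have "4 * ((x/2 + 1/2) * (1 - (x/2 + 1/2))) = 1 - x\<^sup>2"
      by (simp add: field_simps power2_eq_square)
    finally show "4 powr \<alpha> * ((x/2 + 1/2) powr \<alpha> * (1 - (x/2 + 1/2)) powr \<alpha>) = gegenbauer_weight \<alpha> x"
      by (simp add: gegenbauer_weight_def)
  qed
  then have "gegenbauer_weight \<alpha> absolutely_integrable_on {-1..1}"
    by (rule nonnegative_absolutely_integrable_1) (simp add: gegenbauer_weight_def)
  then have "gegenbauer_weight \<alpha> absolutely_integrable_on {-1<..<1}"
    by (rule set_integrable_subset) auto
  then show ?thesis
    unfolding set_integrable_def gegenbauer_weight_def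
    by (subst (asm) integrable_completion) auto
qed

text \<open>The \<open>scaleR\<close> form serves real polynomials and the complex integrand of
  \<open>gauss_remainder\<close> alike. A continuous function is bounded on the closed interval, so
  a multiple of the weight is a majorant.\<close>

lemma set_integrable_weight_scaleR:
  fixes f :: "real \<Rightarrow> 'a::{banach, second_countable_topology}"
  assumes "\<alpha> > -1" "continuous_on {-1..1} f"
  shows "set_integrable lborel {-1<..<1} (\<lambda>x. gegenbauer_weight \<alpha> x *\<^sub>R f x)"
proof -
  have "bounded (f ` {-1..1})"
    by (intro compact_imp_bounded compact_continuous_image assms) auto
  then obtain B where B: "\<And>x. x \<in> {-1..1} \<Longrightarrow> norm (f x) \<le> B"
    unfolding bounded_iff by blast
  have "set_integrable lborel {-1<..<1} (\<lambda>x. B * gegenbauer_weight \<alpha> x)"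
    using set_integrable_gegenbauer_weight[OF assms(1)] by (intro set_integrable_mult_right) auto
  then have B': "integrable lborel (\<lambda>x. indicator {-1<..<1} x *\<^sub>R (B * gegenbauer_weight \<alpha> x))"
    by (simp add: set_integrable_def)
  have "continuous_on {-1<..<1} f" using assms(2) by (rule continuous_on_subset) auto
  then have m: "(\<lambda>x. indicator {-1<..<1} x *\<^sub>R f x) \<in> borel_measurable borel"
    by (intro borel_measurable_continuous_on_indicator) auto
  show ?thesis unfolding set_integrable_def
  proof (rule Bochner_Integration.integrable_bound[OF B'])
    have "(\<lambda>x. gegenbauer_weight \<alpha> x *\<^sub>R (indicator {-1<..<1} x *\<^sub>R f x)) \<in> borel_measurable lborel"
      using m unfolding gegenbauer_weight_def by measurable
    then show "(\<lambda>x. indicator {-1<..<1} x *\<^sub>R (gegenbauer_weight \<alpha> x *\<^sub>R f x)) \<in> borel_measurable lborel"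
      by (simp add: mult.commute)
    show "AE x in lborel. norm (indicator {-1<..<1} x *\<^sub>R (gegenbauer_weight \<alpha> x *\<^sub>R f x))
        \<le> norm (indicator {-1<..<1} x *\<^sub>R (B * gegenbauer_weight \<alpha> x))"
    proof (rule AE_I2)
      fix x :: real
      show "norm (indicator {-1<..<1} x *\<^sub>R (gegenbauer_weight \<alpha> x *\<^sub>R f x))
        \<le> norm (indicator {-1<..<1} x *\<^sub>R (B * gegenbauer_weight \<alpha> x))"
      proof (cases "x \<in> {-1<..<1}")
        case True
        then have "norm (f x) \<le> B" using B by auto
        moreover from this have "0 \<le> B" using norm_ge_zero order_trans by blast
        ultimately show ?thesis using gegenbauer_weight_pos[OF True, of \<alpha>] True
          by (auto simp: abs_mult mult.commute intro!: mult_right_mono)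
      qed simp
    qed
  qed
qed

lemma set_integrable_poly_weight:
  assumes "\<alpha> > -1"
  shows "set_integrable lborel {-1<..<1} (\<lambda>x. poly p x * gegenbauer_weight \<alpha> x)"
  using set_integrable_weight_scaleR[OF assms, of "poly p"] by (simp add: mult.commute continuous_intros)

text \<open>One differentiation in Rodrigues' formula: the exponent drops by one and the polynomial
  factor undergoes p -> (1 - x^2) p' - 2 (\<beta> + 1) x p. The same operator governs the recursion
  of \<open>rodrigues_poly\<close>, the orthogonality and the zeros.\<close>

lemma DERIV_weight_poly:
  assumes "x \<in> {-1<..<1}"
  shows "((\<lambda>t. gegenbauer_weight (\<beta> + 1) t * poly p t) has_real_derivative
     gegenbauer_weight \<beta> x * poly ([:1, 0, -1:] * pderiv p - smult (2 * (\<beta> + 1)) ([:0, 1:] * p)) x) (at x)"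
proof -
  have pos: "0 < 1 - x\<^sup>2" using assms by (rule one_minus_square_pos)
  have "((\<lambda>t. (1 - t\<^sup>2) powr (\<beta> + 1)) has_real_derivative
      (\<beta> + 1) * (1 - x\<^sup>2) powr \<beta> * (- 2 * x)) (at x)"
    using pos by (auto intro!: derivative_eq_intros simp: power2_eq_square)
  note d = DERIV_mult[OF this poly_DERIV[of p x]]
  show ?thesis
    unfolding gegenbauer_weight_def
    by (rule DERIV_cong[OF d])
       (use pos in \<open>simp add: powr_add algebra_simps power2_eq_square\<close>)
qed

text \<open>The integrand is the derivative of a function that vanishes at both endpoints because
  \<beta> + 1 > 0. For negative \<beta> the weight blows up there, so the derivative is used in the
  interior only.\<close>

lemma integral_weight_poly_boundary:
  assumes "\<beta> > -1"
  shows "(LBINT x:{-1<..<1}. poly ([:1, 0, -1:] * pderiv p - smult (2 * (\<beta> + 1)) ([:0, 1:] * p)) x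
            * gegenbauer_weight \<beta> x) = 0"
proof -
  let ?r = "[:1, 0, -1:] * pderiv p - smult (2 * (\<beta> + 1)) ([:0, 1:] * p)"
  let ?F = "\<lambda>t. gegenbauer_weight (\<beta> + 1) t * poly p t"
  have "((\<lambda>x. poly ?r x * gegenbauer_weight \<beta> x) has_integral (?F 1 - ?F (-1))) {-1..1}"
  proof (rule fundamental_theorem_of_calculus_interior)
    show "continuous_on {-1..1} ?F"
      unfolding gegenbauer_weight_def using assms
      by (intro continuous_on_mult continuous_on_powr' continuous_intros)
         (auto simp: abs_square_le_1)
  next
    fix x :: real assume "x \<in> {-1<..<1}"
    from DERIV_weight_poly[OF this, of \<beta> p]
    show "(?F has_vector_derivative poly ?r x * gegenbauer_weight \<beta> x) (at x)"
      by (simp add: has_real_derivative_iff_has_vector_derivative mult.commute del: poly_diff poly_mult poly_smult)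
  qed auto
  moreover have "?F 1 - ?F (-1) = 0" using assms by (simp add: gegenbauer_weight_def)
  ultimately have "((\<lambda>x. poly ?r x * gegenbauer_weight \<beta> x) has_integral 0) {-1<..<1}"
    by (simp add: has_integral_Icc_iff_Ioo)
  then show ?thesis
    using set_borel_integral_eq_integral(2)[OF set_integrable_poly_weight[OF assms]]
    by (metis integral_unique)
qed

text \<open>The recursion comes from Rodrigues' formula: the first \<open>n\<close> of the \<open>n + 1\<close> derivatives form the
  formula of degree \<open>n\<close> for the parameter \<open>\<alpha> + 1\<close>.\<close>
fun rodrigues_poly :: "nat \<Rightarrow> real \<Rightarrow> real poly" where
  "rodrigues_poly 0 \<alpha> = 1"
| "rodrigues_poly (Suc n) \<alpha> = smult (- 1 / (2 * real (Suc n)))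
     ([:1, 0, -1:] * pderiv (rodrigues_poly n (\<alpha> + 1)) - smult (2 * (\<alpha> + 1)) ([:0, 1:] * rodrigues_poly n (\<alpha> + 1)))"

lemma rodrigues_formula:
  assumes "x \<in> {-1<..<1}"
  shows "(deriv ^^ n) (\<lambda>t. (1 - t\<^sup>2) powr (\<alpha> + real n)) x
    = (-1) ^ n * 2 ^ n * fact n * (gegenbauer_weight \<alpha> x * poly (rodrigues_poly n \<alpha>) x)"
  using assms
proof (induction n arbitrary: \<alpha> x)
  case 0
  then show ?case by (simp add: gegenbauer_weight_def)
next
  case (Suc n)
  let ?f = "(deriv ^^ n) (\<lambda>t. (1 - t\<^sup>2) powr (\<alpha> + real (Suc n)))"
  let ?c = "(-1) ^ n * 2 ^ n * fact n :: real"
  let ?r = "[:1, 0, -1:] * pderiv (rodrigues_poly n (\<alpha> + 1)) - smult (2 * (\<alpha> + 1)) ([:0, 1:] * rodrigues_poly n (\<alpha> + 1))"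
  have eq: "?c * (gegenbauer_weight (\<alpha> + 1) t * poly (rodrigues_poly n (\<alpha> + 1)) t) = ?f t"
    if "t \<in> {-1<..<1}" for t
    using Suc.IH[OF that, of "\<alpha> + 1"] by (simp add: add_ac)
  have "((\<lambda>t. ?c * (gegenbauer_weight (\<alpha> + 1) t * poly (rodrigues_poly n (\<alpha> + 1)) t))
     has_real_derivative ?c * (gegenbauer_weight \<alpha> x * poly ?r x)) (at x)"
    by (rule DERIV_cmult[OF DERIV_weight_poly[OF Suc.prems]])
  \<comment> \<open>The induction hypothesis identifies the two functions only on the open interval,
    which suffices for the derivative at an interior point.\<close>
  then have "(?f has_real_derivative ?c * (gegenbauer_weight \<alpha> x * poly ?r x)) (at x)"
    by (rule has_field_derivative_transform_within_open[OF _ open_greaterThanLessThan Suc.prems eq])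
  then have "deriv ?f x = ?c * (gegenbauer_weight \<alpha> x * poly ?r x)"
    by (rule DERIV_imp_deriv)
  then show ?case
    by (simp add: field_simps del: poly_diff poly_mult of_nat_Suc)
qed

lemma jacobi_poly_eq_rodrigues_poly: "jacobi_poly \<alpha> n = rodrigues_poly n \<alpha>"
  unfolding jacobi_poly_def
proof (rule the_equality)
  let ?P = "\<lambda>p. \<forall>x\<in>{-1<..<1}. gegenbauer_weight \<alpha> x * poly p x =
       (-1) ^ n / (2 ^ n * fact n) * (deriv ^^ n) (\<lambda>t. (1 - t\<^sup>2) powr (\<alpha> + real n)) x"
  have one: "(-1) ^ n * (-1) ^ n = (1::real)" by (simp flip: power_mult_distrib)
  show P: "?P (rodrigues_poly n \<alpha>)"
    using one by (auto simp: rodrigues_formula)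
  fix p assume p: "?P p"
  show "p = rodrigues_poly n \<alpha>"
  proof (rule poly_eq_on_interval)
    fix x :: real assume x: "x \<in> {-1<..<1}"
    have "gegenbauer_weight \<alpha> x * poly p x = gegenbauer_weight \<alpha> x * poly (rodrigues_poly n \<alpha>) x"
      using P p x by simp
    then show "poly p x = poly (rodrigues_poly n \<alpha>) x"
      using gegenbauer_weight_pos[OF x, of \<alpha>] by simp
  qed
qed

section \<open>Degree and leading coefficient\<close>

lemma degree_rodrigues_poly_le: "degree (rodrigues_poly n \<alpha>) \<le> n"
proof (induction n arbitrary: \<alpha>)
  case (Suc n)
  have "degree ([:1, 0, -1:] * pderiv (rodrigues_poly n (\<alpha> + 1))) \<le> Suc n"
  proof (cases "n = 0")
    case True
    then show ?thesis by simp
  next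
    case False
    have "degree ([:1, 0, -1:] * pderiv (rodrigues_poly n (\<alpha> + 1)))
      \<le> degree [:1, 0, -1::real:] + degree (pderiv (rodrigues_poly n (\<alpha> + 1)))" by (rule degree_mult_le)
    also have "\<dots> \<le> 2 + (n - 1)" using Suc.IH[of "\<alpha> + 1"] by (simp add: degree_pderiv)
    finally show ?thesis using False by simp
  qed
  moreover have "degree ([:0, 1:] * rodrigues_poly n (\<alpha> + 1)) \<le> Suc n"
    by (rule order_trans[OF degree_mult_le]) (use Suc.IH[of "\<alpha> + 1"] in simp)
  ultimately show ?case
    using degree_smult_le by (auto intro!: order_trans[OF degree_smult_le] degree_diff_le simp del: mult_pCons_left)
qed simp

lemma coeff_one_minus_square_mult_pderiv:
  fixes p :: "real poly"
  assumes "degree p \<le> n"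
  shows "coeff ([:1, 0, -1:] * pderiv p) (Suc n) = - real n * coeff p n"
proof -
  have "[:1, 0, -1:] = 1 - (monom 1 2 :: real poly)"
    by (rule poly_eqI) (auto simp: coeff_pCons split: nat.splits)
  then have "[:1, 0, -1:] * pderiv p = pderiv p - monom 1 2 * pderiv p"
    by (simp only: left_diff_distrib mult_1_left)
  then have "coeff ([:1, 0, -1:] * pderiv p) (Suc n) = coeff (pderiv p) (Suc n) - coeff (monom 1 2 * pderiv p) (Suc n)"
    by simp
  also have "coeff (pderiv p) (Suc n) = 0" using assms by (simp add: coeff_pderiv coeff_eq_0)
  also have "coeff (monom 1 2 * pderiv p) (Suc n) = real n * coeff p n"
    by (cases n) (auto simp: coeff_monom_mult coeff_pderiv)
  finally show ?thesis by simp
qed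

text \<open>Each step multiplies the top coefficient by (n + 2 \<alpha> + 2) / (2 (n + 1)), which is
  positive for \<alpha> > -1; hence the degree is exactly n.\<close>

lemma coeff_rodrigues_poly_pos:
  assumes "\<alpha> > -1"
  shows "coeff (rodrigues_poly n \<alpha>) n > 0"
  using assms
proof (induction n arbitrary: \<alpha>)
  case (Suc n)
  let ?p = "rodrigues_poly n (\<alpha> + 1)"
  have pos: "coeff ?p n > 0" using Suc by simp
  have "coeff ([:1, 0, -1:] * pderiv ?p) (Suc n) = - real n * coeff ?p n"
    by (rule coeff_one_minus_square_mult_pderiv[OF degree_rodrigues_poly_le])
  then have "coeff (rodrigues_poly (Suc n) \<alpha>) (Suc n) = (real n + 2 * (\<alpha> + 1)) / (2 * real (Suc n)) * coeff ?p n"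
    by (simp add: field_simps del: mult_pCons_left of_nat_Suc) (simp add: algebra_simps)
  moreover have "(real n + 2 * (\<alpha> + 1)) / (2 * real (Suc n)) > 0"
    using Suc.prems by (intro divide_pos_pos) auto
  ultimately show ?case using pos by (metis mult_pos_pos)
qed simp

lemma degree_rodrigues_poly: "\<alpha> > -1 \<Longrightarrow> degree (rodrigues_poly n \<alpha>) = n"
  using coeff_rodrigues_poly_pos[of \<alpha> n] degree_rodrigues_poly_le[of n \<alpha>] le_degree[of "rodrigues_poly n \<alpha>" n]
  by force

text \<open>Integration by parts: moving q inside the derivative leaves an exact derivative, which
  integrates to 0, and a term with q' whose factor 1 - x^2 is absorbed into the weight.\<close>

lemma integral_rodrigues_poly:
  assumes "\<alpha> > -1"
  shows "(LBINT x:{-1<..<1}. poly (q * rodrigues_poly (Suc n) \<alpha>) x * gegenbauer_weight \<alpha> x)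
   = 1 / (2 * real (Suc n)) * (LBINT x:{-1<..<1}. poly (pderiv q * rodrigues_poly n (\<alpha> + 1)) x * gegenbauer_weight (\<alpha> + 1) x)"
proof -
  let ?p = "rodrigues_poly n (\<alpha> + 1)"
  let ?c = "1 / (2 * real (Suc n))"
  let ?r = "[:1, 0, -1:] * pderiv (q * ?p) - smult (2 * (\<alpha> + 1)) ([:0, 1:] * (q * ?p))"
  let ?s = "[:1, 0, -1:] * (pderiv q * ?p)"
  have id: "q * rodrigues_poly (Suc n) \<alpha> = smult ?c (?s - ?r)"
    by (simp add: pderiv_mult algebra_simps smult_diff_right smult_add_right del: mult_pCons_left mult_pCons_right)
  have "(LBINT x:{-1<..<1}. poly (q * rodrigues_poly (Suc n) \<alpha>) x * gegenbauer_weight \<alpha> x)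
     = (LBINT x:{-1<..<1}. ?c * (poly ?s x * gegenbauer_weight \<alpha> x - poly ?r x * gegenbauer_weight \<alpha> x))"
    unfolding id by (simp add: algebra_simps del: poly_mult mult_pCons_left)
  also have "\<dots> = ?c * ((LBINT x:{-1<..<1}. poly ?s x * gegenbauer_weight \<alpha> x)
       - (LBINT x:{-1<..<1}. poly ?r x * gegenbauer_weight \<alpha> x))"
    by (simp only: set_integral_mult_right set_integral_diff set_integrable_poly_weight[OF assms])
  also have "(LBINT x:{-1<..<1}. poly ?r x * gegenbauer_weight \<alpha> x) = 0"
    by (rule integral_weight_poly_boundary[OF assms])
  also have "(LBINT x:{-1<..<1}. poly ?s x * gegenbauer_weight \<alpha> x)
     = (LBINT x:{-1<..<1}. poly (pderiv q * ?p) x * gegenbauer_weight (\<alpha> + 1) x)"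
    by (rule set_lebesgue_integral_cong)
       (auto simp: gegenbauer_weight_Suc[of _ \<alpha>, unfolded add.commute[of \<alpha>]] power2_eq_square algebra_simps)
  finally show ?thesis by simp
qed

lemma rodrigues_poly_orthogonal:
  assumes "\<alpha> > -1" "degree q < n"
  shows "(LBINT x:{-1<..<1}. poly (q * rodrigues_poly n \<alpha>) x * gegenbauer_weight \<alpha> x) = 0"
  using assms
proof (induction n arbitrary: \<alpha> q)
  case (Suc n)
  have "(LBINT x:{-1<..<1}. poly (pderiv q * rodrigues_poly n (\<alpha> + 1)) x * gegenbauer_weight (\<alpha> + 1) x) = 0"
  \<comment> \<open>For n = 0 the strict degree bound of the induction hypothesis cannot hold, but q
    is constant and q' vanishes.\<close>
  proof (cases "n = 0")
    case True
    then have "pderiv q = 0" using Suc.prems by (simp add: pderiv_eq_0_iff)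
    then show ?thesis by simp
  next
    case False
    then show ?thesis using Suc.prems by (intro Suc.IH) (auto simp: degree_pderiv)
  qed
  then show ?case using integral_rodrigues_poly[OF Suc.prems(1), of q n] by simp
qed simp

section \<open>Gauss quadrature\<close>

text \<open>Induction adds the largest zero last. The conjunct \<open>x < Max S\<close> keeps the
  earlier critical points to the left of the new one, so that it is really new.\<close>

lemma Rolle_finite:
  fixes f f' :: "real \<Rightarrow> real"
  assumes "finite S" "S \<noteq> {}" "S \<subseteq> {a..b}" "\<And>x. x \<in> S \<Longrightarrow> f x = 0"
    and cont: "continuous_on {a..b} f"
    and der: "\<And>x. x \<in> {a<..<b} \<Longrightarrow> (f has_real_derivative f' x) (at x)"
  shows "\<exists>T. finite T \<and> card S = Suc (card T) \<and> T \<subseteq> {a<..<b} \<and> (\<forall>x\<in>T. x < Max S \<and> f' x = 0)"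
  using assms(1-4)
proof (induction S rule: finite_linorder_max_induct)
  case (insert y S)
  show ?case
  proof (cases "S = {}")
    case True
    then show ?thesis by (intro exI[of _ "{}"]) auto
  next
    case False
    then obtain T where T: "finite T" "card S = Suc (card T)" "T \<subseteq> {a<..<b}" "\<forall>x\<in>T. x < Max S \<and> f' x = 0"
      using insert by auto
    let ?m = "Max S"
    have m: "?m \<in> S" using False insert.hyps by simp
    then have lt: "?m < y" using insert.hyps by blast
    have sub: "{?m..y} \<subseteq> {a..b}" using m insert.prems by auto
    have "f ?m = 0" "f y = 0" using m insert.prems by blast+
    then have "\<exists>z. ?m < z \<and> z < y \<and> DERIV f z :> 0"
    proof (intro Rolle)
      show "continuous_on {?m..y} f" using cont sub by (rule continuous_on_subset)
      fix x assume "?m < x" "x < y"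
      then have "x \<in> {a<..<b}" using m insert.prems by force
      then show "f differentiable (at x)" using der real_differentiable_def by blast
    qed (use lt in auto)
    then obtain z where z: "?m < z" "z < y" "DERIV f z :> 0" by blast
    have zab: "z \<in> {a<..<b}" using z m insert.prems by force
    then have "f' z = 0" using DERIV_unique[OF z(3) der] by simp
    moreover have "Max (insert y S) = y" using insert.hyps by (intro Max_eqI) (auto intro: less_imp_le)
    moreover have "z \<notin> T" "y \<notin> S" using T z insert.hyps by force+
    ultimately show ?thesis using T z zab lt insert.hyps
      by (intro exI[of _ "insert z T"]) force
  qed
qed simp

text \<open>The function differentiated in Rodrigues' formula vanishes at the n zeros for \<alpha> +
  1 and, through the weight, at -1 and 1. These n + 2 zeros give n + 1 zeros of its derivative
  inside the interval.\<close>

lemma rodrigues_poly_roots: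
  assumes "\<alpha> > -1"
  shows "\<exists>T. finite T \<and> card T = n \<and> T \<subseteq> {-1<..<1} \<and> (\<forall>x\<in>T. poly (rodrigues_poly n \<alpha>) x = 0)"
  using assms
proof (induction n arbitrary: \<alpha>)
  case 0
  show ?case by (intro exI[of _ "{}"]) auto
next
  case (Suc n)
  then have "\<alpha> + 1 > -1" by simp
  from Suc.IH[OF this] obtain T where T: "finite T" "card T = n" "T \<subseteq> {-1<..<1}" "\<forall>x\<in>T. poly (rodrigues_poly n (\<alpha> + 1)) x = 0"
    by blast
  let ?p = "rodrigues_poly n (\<alpha> + 1)"
  let ?F = "\<lambda>t. gegenbauer_weight (\<alpha> + 1) t * poly ?p t"
  let ?F' = "\<lambda>t. gegenbauer_weight \<alpha> t * poly ([:1, 0, -1:] * pderiv ?p - smult (2 * (\<alpha> + 1)) ([:0, 1:] * ?p)) t"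
  let ?S = "insert (-1) (insert 1 T)"
  have "\<exists>T'. finite T' \<and> card ?S = Suc (card T') \<and> T' \<subseteq> {-1<..<1} \<and> (\<forall>x\<in>T'. x < Max ?S \<and> ?F' x = 0)"
  proof (rule Rolle_finite)
    show "continuous_on {-1..1} ?F"
      unfolding gegenbauer_weight_def using Suc.prems
      by (intro continuous_on_mult continuous_on_powr' continuous_intros)
         (auto simp: abs_square_le_1)
  qed (use T DERIV_weight_poly in \<open>auto simp: gegenbauer_weight_def simp del: poly_diff poly_mult\<close>)
  moreover have "card ?S = n + 2" using T by (auto simp: card_insert_if)
  ultimately obtain T' where T': "finite T'" "card T' = Suc n" "T' \<subseteq> {-1<..<1}" "\<forall>x\<in>T'. ?F' x = 0"
    by auto
  have "poly (rodrigues_poly (Suc n) \<alpha>) x = 0" if "x \<in> T'" for x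
  proof -
    have "gegenbauer_weight \<alpha> x > 0" using that T' gegenbauer_weight_pos by blast
    moreover have "?F' x = 0" using that T' by blast
    ultimately have "poly ([:1, 0, -1:] * pderiv ?p - smult (2 * (\<alpha> + 1)) ([:0, 1:] * ?p)) x = 0"
      by (simp del: poly_diff poly_mult poly_smult)
    then show ?thesis by (simp del: poly_diff poly_mult)
  qed
  then show ?case using T' by blast
qed

lemma rodrigues_poly_nonzero: "\<alpha> > -1 \<Longrightarrow> rodrigues_poly n \<alpha> \<noteq> 0"
  using coeff_rodrigues_poly_pos[of \<alpha> n] by auto

text \<open>The n zeros supplied by Rolle's theorem already exhaust the degree.\<close>

lemma gauss_nodes_properties:
  assumes "\<alpha> > -1"
  shows finite_gauss_nodes: "finite (gauss_nodes \<alpha> n)"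
    and card_gauss_nodes: "card (gauss_nodes \<alpha> n) = n"
    and gauss_nodes_subset: "gauss_nodes \<alpha> n \<subseteq> {-1<..<1}"
proof -
  obtain T where T: "finite T" "card T = n" "T \<subseteq> {-1<..<1}" "\<forall>x\<in>T. poly (rodrigues_poly n \<alpha>) x = 0"
    using rodrigues_poly_roots[OF assms] by blast
  show fin: "finite (gauss_nodes \<alpha> n)"
    using poly_roots_finite[OF rodrigues_poly_nonzero[OF assms]]
    by (simp add: gauss_nodes_def jacobi_poly_eq_rodrigues_poly)
  have "T \<subseteq> gauss_nodes \<alpha> n" using T by (auto simp: gauss_nodes_def jacobi_poly_eq_rodrigues_poly)
  moreover have "card (gauss_nodes \<alpha> n) \<le> n"
    using card_poly_roots_bound[OF rodrigues_poly_nonzero[OF assms], of n] degree_rodrigues_poly[OF assms, of n]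
    by (simp add: gauss_nodes_def jacobi_poly_eq_rodrigues_poly)
  ultimately have "T = gauss_nodes \<alpha> n"
    using fin T card_seteq by metis
  then show "card (gauss_nodes \<alpha> n) = n" "gauss_nodes \<alpha> n \<subseteq> {-1<..<1}" using T by auto
qed

text \<open>The real-valued form of \<open>gauss_remainder\<close> on real polynomials, so that the
  algebra of the U_k stays in \<open>real poly\<close>; \<open>gauss_remainder_poly\<close> is the
  link.\<close>

definition poly_remainder :: "real \<Rightarrow> nat \<Rightarrow> real poly \<Rightarrow> real" where
  "poly_remainder \<alpha> n p = (LBINT x:{-1<..<1}. poly p x * gegenbauer_weight \<alpha> x)
     - (\<Sum>x\<in>gauss_nodes \<alpha> n. poly p x * gauss_weight \<alpha> n x)"

lemma poly_remainder_add:
  assumes "\<alpha> > -1"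
  shows "poly_remainder \<alpha> n (p + q) = poly_remainder \<alpha> n p + poly_remainder \<alpha> n q"
  by (simp add: poly_remainder_def algebra_simps sum.distrib
      set_integral_add(2)[OF set_integrable_poly_weight[OF assms] set_integrable_poly_weight[OF assms], simplified mult.commute[of _ "gegenbauer_weight _ _"]])

lemma poly_remainder_smult: "poly_remainder \<alpha> n (smult c p) = c * poly_remainder \<alpha> n p"
  by (simp add: poly_remainder_def right_diff_distrib sum_distrib_left mult.assoc)

lemma poly_remainder_diff:
  "\<alpha> > -1 \<Longrightarrow> poly_remainder \<alpha> n (p - q) = poly_remainder \<alpha> n p - poly_remainder \<alpha> n q"
  using poly_remainder_add[of \<alpha> n p "smult (-1) q"] poly_remainder_smult[of \<alpha> n "-1" q] by simp

lemma poly_remainder_sum: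
  assumes "\<alpha> > -1"
  shows "poly_remainder \<alpha> n (\<Sum>i\<in>I. f i) = (\<Sum>i\<in>I. poly_remainder \<alpha> n (f i))"
proof -
  have "poly_remainder \<alpha> n 0 = 0" by (simp add: poly_remainder_def)
  then show ?thesis
    by (induction I rule: infinite_finite_induct) (simp_all add: poly_remainder_add[OF assms])
qed

lemma poly_remainder_jacobi_mult:
  "poly_remainder \<alpha> n (q * jacobi_poly \<alpha> n) =
     (LBINT x:{-1<..<1}. poly (q * jacobi_poly \<alpha> n) x * gegenbauer_weight \<alpha> x)"
  by (simp add: poly_remainder_def gauss_nodes_def)

text \<open>Interpolation at the n nodes reproduces p, and for a Lagrange basis polynomial the
  quadrature sum reduces to a single \<open>gauss_weight\<close>, which is by definition its
  integral.\<close>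

lemma poly_remainder_low_degree:
  assumes "\<alpha> > -1" "degree p < n"
  shows "poly_remainder \<alpha> n p = 0"
proof -
  let ?N = "gauss_nodes \<alpha> n"
  note fin = finite_gauss_nodes[OF assms(1), of n]
  note card = card_gauss_nodes[OF assms(1), of n]
  define L where "L x = (\<Prod>y\<in>?N - {x}. smult (1 / (x - y)) [:- y, 1:])" for x
  have L: "poly (L x) t = (\<Prod>y\<in>?N - {x}. (t - y) / (x - y))" for x t
    by (simp add: L_def poly_prod diff_divide_distrib)
  have L_node: "poly (L x) z = (if z = x then 1 else 0)" if "z \<in> ?N" "x \<in> ?N" for x z
    unfolding L using that fin by (auto intro!: prod.neutral)
  have deg: "degree (L x) < n" if "x \<in> ?N" for x
  proof -
    have "degree (L x) \<le> (\<Sum>y\<in>?N - {x}. degree (smult (1 / (x - y)) [:- y, 1:]))"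
      unfolding L_def using fin by (intro degree_prod_sum_le[unfolded o_def]) auto
    also have "\<dots> \<le> (\<Sum>y\<in>?N - {x}. 1)" by (intro sum_mono) auto
    also have "\<dots> < n" using card_gt_0_iff[of ?N] fin card that by auto
    finally show ?thesis .
  qed
  have "p = (\<Sum>x\<in>?N. smult (poly p x) (L x))"
  proof (rule poly_eqI_degree[of ?N])
    fix z assume "z \<in> ?N"
    then show "poly p z = poly (\<Sum>x\<in>?N. smult (poly p x) (L x)) z"
      using fin by (simp add: poly_sum L_node if_distrib[of "\<lambda>a. _ * a"] cong: if_cong)
  next
    show "degree (\<Sum>x\<in>?N. smult (poly p x) (L x)) < card ?N"
      unfolding card using assms(2) deg degree_smult_le
      by (intro degree_sum_less) (auto intro: le_less_trans[OF degree_smult_le])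
  qed (use assms card in simp)
  moreover have "poly_remainder \<alpha> n (L x) = 0" if "x \<in> ?N" for x
  proof -
    have "(\<Sum>z\<in>?N. poly (L x) z * gauss_weight \<alpha> n z) = (\<Sum>z\<in>?N. if z = x then gauss_weight \<alpha> n z else 0)"
      by (intro sum.cong) (auto simp: L_node that)
    also have "\<dots> = gauss_weight \<alpha> n x" using fin that by simp
    finally show ?thesis by (simp add: poly_remainder_def gauss_weight_def L)
  qed
  ultimately show ?thesis
    using poly_remainder_sum[OF assms(1), of n "\<lambda>x. smult (poly p x) (L x)" ?N]
    by (simp add: poly_remainder_smult)
qed

text \<open>Gauss' argument: divide by the Jacobi polynomial. The multiple is annihilated by
  orthogonality, as the quotient has degree below n, and the rest is interpolated exactly.\<close>

lemma poly_remainder_exact: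
  assumes "\<alpha> > -1" "degree p < 2 * n"
  shows "poly_remainder \<alpha> n p = 0"
proof -
  let ?J = "rodrigues_poly n \<alpha>"
  have J: "?J \<noteq> 0" "degree ?J = n"
    using rodrigues_poly_nonzero degree_rodrigues_poly assms(1) by auto
  have n: "0 < n" using assms(2) by simp
  let ?q = "p div ?J" and ?r = "p mod ?J"
  have r: "degree ?r < n" using degree_mod_less[OF J(1), of p] J(2) n by auto
  have "degree ?q < n"
  proof (cases "?q = 0")
    case False
    have "degree (?q * ?J) = degree (p - ?r)" by (simp add: minus_mod_eq_div_mult)
    also have "\<dots> < 2 * n" using assms r by (intro degree_diff_less) auto
    finally show ?thesis using False J by (simp add: degree_mult_eq)
  qed (use n in simp)
  then have "poly_remainder \<alpha> n (?q * ?J) = 0"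
    using poly_remainder_jacobi_mult[of \<alpha> n ?q] rodrigues_poly_orthogonal[OF assms(1)]
    by (simp add: jacobi_poly_eq_rodrigues_poly)
  moreover have "poly_remainder \<alpha> n ?r = 0"
    using poly_remainder_low_degree[OF assms(1) r] .
  ultimately have "poly_remainder \<alpha> n (?q * ?J + ?r) = 0"
    by (simp add: poly_remainder_add[OF assms(1)] del: div_mult_mod_eq)
  then show ?thesis by (simp only: div_mult_mod_eq)
qed

text \<open>If the integral were 0, the interval without the finitely many nodes would be a null
  set. Positivity is used to clear the factor 1 / \<gamma> in
  \<open>gegenbauer_sigma\<close>.\<close>

lemma jacobi_norm_pos:
  assumes "\<alpha> > -1"
  shows "jacobi_norm \<alpha> n > 0"
proof -
  let ?J = "rodrigues_poly n \<alpha>"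
  let ?f = "\<lambda>x. (poly ?J x)\<^sup>2 * gegenbauer_weight \<alpha> x"
  have int: "set_integrable lborel {-1<..<1} ?f"
    using set_integrable_poly_weight[OF assms, of "?J\<^sup>2"] by simp
  have nn: "0 \<le> ?f x" for x by (simp add: gegenbauer_weight_def)
  have "jacobi_norm \<alpha> n = (LBINT x:{-1<..<1}. ?f x)"
    by (simp add: jacobi_norm_def jacobi_poly_eq_rodrigues_poly)
  moreover have "(LBINT x:{-1<..<1}. ?f x) \<ge> 0"
    unfolding set_lebesgue_integral_def by (intro integral_nonneg_AE) (simp add: nn)
  moreover have "(LBINT x:{-1<..<1}. ?f x) \<noteq> 0"
  proof
    assume "(LBINT x:{-1<..<1}. ?f x) = 0"
    then have "AE x in lborel. indicator {-1<..<1} x *\<^sub>R ?f x = 0"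
      using integral_nonneg_eq_0_iff_AE[of lborel "\<lambda>x. indicator {-1<..<1} x *\<^sub>R ?f x"] int nn
      unfolding set_integrable_def set_lebesgue_integral_def by simp
    then have "AE x in lborel. x \<notin> {-1<..<1::real} - gauss_nodes \<alpha> n"
    proof eventually_elim
      case (elim x)
      then show ?case using gegenbauer_weight_pos[of x \<alpha>]
        by (auto simp: indicator_def gauss_nodes_def jacobi_poly_eq_rodrigues_poly split: if_splits)
    qed
    moreover have "AE x in lborel. x \<notin> gauss_nodes \<alpha> n"
      using finite_imp_null_set_lborel[OF finite_gauss_nodes[OF assms]] by (rule AE_not_in)
    ultimately have "AE x in lborel. x \<notin> {-1<..<1::real}" by eventually_elim auto
    then have "emeasure lborel {-1<..<1::real} = 0"
      by (subst (asm) AE_iff_null_sets[symmetric]) auto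
    then show False by simp
  qed
  ultimately show ?thesis by simp
qed

section \<open>Chebyshev polynomials and the cosine expansion\<close>

text \<open>The factor sin t, kept on the left instead of divided out, makes the identity valid for
  every t.\<close>

lemma chebyshev_U_cos: "poly (chebyshev_U k) (cos t) * sin t = sin (real (k + 1) * t)"
proof (induction k rule: chebyshev_U.induct)
  case 2
  show ?case using sin_double[of t] by (simp add: mult_ac)
next
  case (3 k)
  have "poly (chebyshev_U (Suc (Suc k))) (cos t) * sin t
     = 2 * cos t * (poly (chebyshev_U (Suc k)) (cos t) * sin t) - poly (chebyshev_U k) (cos t) * sin t"
    by (simp add: algebra_simps)
  also have "\<dots> = 2 * cos t * sin (real (k + 2) * t) - sin (real (k + 1) * t)"
    using 3 by simp
  also have "\<dots> = sin (real (k + 3) * t)"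
    using sin_add[of "real (k + 2) * t" t] sin_diff[of "real (k + 2) * t" t]
    by (simp add: algebra_simps)
  finally show ?case by (simp add: add_ac)
qed simp

lemma degree_chebyshev_U_le: "degree (chebyshev_U k) \<le> k"
proof (induction k rule: chebyshev_U.induct)
  case (3 k)
  have "degree ([:0, 2:] * chebyshev_U (Suc k)) \<le> Suc (Suc k)"
    by (rule order_trans[OF degree_mult_le]) (use 3 in simp)
  then show ?case using 3 by (auto intro!: degree_diff_le simp del: mult_pCons_left)
qed auto

text \<open>Defined through 2 T_k = U_k - U_{k-2}, so that remainders of T_k reduce to those of U at
  once; \<open>chebyshev_T_cos\<close> identifies the usual Chebyshev polynomials.\<close>

fun chebyshev_T :: "nat \<Rightarrow> real poly" where
  "chebyshev_T 0 = 1"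
| "chebyshev_T (Suc 0) = [:0, 1:]"
| "chebyshev_T (Suc (Suc k)) = smult (1 / 2) (chebyshev_U (Suc (Suc k)) - chebyshev_U k)"

lemma degree_chebyshev_T_le: "degree (chebyshev_T k) \<le> k"
proof (cases k rule: chebyshev_T.cases)
  case (3 j)
  show ?thesis unfolding 3 chebyshev_T.simps
    using degree_chebyshev_U_le[of "Suc (Suc j)"] degree_chebyshev_U_le[of j]
    by (intro order_trans[OF degree_smult_le] degree_diff_le) auto
qed auto

lemma chebyshev_T_cos:
  assumes "sin t \<noteq> 0"
  shows "poly (chebyshev_T k) (cos t) = cos (real k * t)"
proof (cases k rule: chebyshev_T.cases)
  case (3 j)
  have "poly (chebyshev_T k) (cos t) * sin t
     = 1/2 * (poly (chebyshev_U (Suc (Suc j))) (cos t) * sin t - poly (chebyshev_U j) (cos t) * sin t)"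
    unfolding 3 by (simp add: algebra_simps del: chebyshev_U.simps)
  also have "\<dots> = 1/2 * (sin (real (j + 3) * t) - sin (real (j + 1) * t))"
    unfolding chebyshev_U_cos by (simp add: add_ac)
  also have "\<dots> = cos (real k * t) * sin t"
    unfolding 3 using sin_add[of "real (j + 2) * t" t] sin_diff[of "real (j + 2) * t" t]
    by (simp add: algebra_simps)
  finally show ?thesis using assms by simp
qed auto

lemma interval_cosE:
  assumes "x \<in> {-1<..<1::real}"
  obtains t where "x = cos t" "t \<in> {0<..<pi}" "sin t > 0"
proof
  show "x = cos (arccos x)" using assms by simp
  show "arccos x \<in> {0<..<pi}" using assms arccos_lt_bounded by auto
  then show "sin (arccos x) > 0" using sin_gt_zero by auto
qed

text \<open>The frequencies run through n, n - 2, ..., -n, so opposite ones are both listed. This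
  redundant form admits the symmetric product coefficients of the Gegenbauer expansion and needs no
  distinction by the parity of n.\<close>

definition has_cos_coeffs :: "real poly \<Rightarrow> nat \<Rightarrow> (nat \<Rightarrow> real) \<Rightarrow> bool" where
  "has_cos_coeffs p n c \<longleftrightarrow> (\<forall>t. poly p (cos t) = (\<Sum>k\<le>n. c k * cos ((real n - 2 * real k) * t)))"

text \<open>Applied to cos(m t), the operator of the recursion yields products sin(m t) sin t and
  cos(m t) cos t, hence frequencies m + 1 and m - 1. The new coefficient with index k + 1 collects
  the upper share of the old k + 1 and the lower share of the old k; at both ends one share is
  missing.\<close>

lemma has_cos_coeffs_rodrigues_Suc:
  assumes p: "has_cos_coeffs (rodrigues_poly n (\<alpha> + 1)) n c"
    and d0: "d 0 = (real n + 2 * \<alpha> + 2) / (4 * real (Suc n)) * c 0"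
    and dn: "d (Suc n) = (real n + 2 * \<alpha> + 2) / (4 * real (Suc n)) * c n"
    and dk: "\<And>k. k < n \<Longrightarrow> d (Suc k) = ((real n - 2 * real (Suc k) + 2 * \<alpha> + 2) * c (Suc k)
        + (2 * \<alpha> + 2 - real n + 2 * real k) * c k) / (4 * real (Suc n))"
  shows "has_cos_coeffs (rodrigues_poly (Suc n) \<alpha>) (Suc n) d"
  unfolding has_cos_coeffs_def
proof
  fix t :: real
  let ?p = "rodrigues_poly n (\<alpha> + 1)"
  let ?m = "\<lambda>k. real n - 2 * real k"
  have p': "poly ?p (cos s) = (\<Sum>k\<le>n. c k * cos (?m k * s))" for s
    using p by (simp add: has_cos_coeffs_def)
  \<comment> \<open>Differentiating p(cos s) by the chain rule and termwise gives the sine expansion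
    of p'(cos t) sin t.\<close>
  have "((\<lambda>s. poly ?p (cos s)) has_real_derivative poly (pderiv ?p) (cos t) * (- sin t)) (at t)"
    by (auto intro!: derivative_eq_intros)
  moreover have "((\<lambda>s. poly ?p (cos s)) has_real_derivative (\<Sum>k\<le>n. c k * (- sin (?m k * t) * ?m k))) (at t)"
    unfolding p' by (auto intro!: derivative_eq_intros simp: mult_ac)
  ultimately have "poly (pderiv ?p) (cos t) * (- sin t) = (\<Sum>k\<le>n. c k * (- sin (?m k * t) * ?m k))"
    by (rule DERIV_unique)
  then have "- sin t * (poly (pderiv ?p) (cos t) * (- sin t)) = - sin t * (\<Sum>k\<le>n. c k * (- sin (?m k * t) * ?m k))"
    by simp
  moreover have "- sin t * (poly (pderiv ?p) (cos t) * (- sin t)) = (1 - (cos t)\<^sup>2) * poly (pderiv ?p) (cos t)"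
    using sin_squared_eq[of t] by (simp add: power2_eq_square)
  moreover have "- sin t * (\<Sum>k\<le>n. c k * (- sin (?m k * t) * ?m k)) = (\<Sum>k\<le>n. c k * ?m k * (sin (?m k * t) * sin t))"
    unfolding sum_distrib_left by (rule sum.cong) (simp_all add: algebra_simps)
  ultimately have pd: "(1 - (cos t)\<^sup>2) * poly (pderiv ?p) (cos t) = (\<Sum>k\<le>n. c k * ?m k * (sin (?m k * t) * sin t))"
    by simp
  \<comment> \<open>The shares of the k-th term in the frequencies m + 1 and m - 1.\<close>
  let ?a = "\<lambda>k. (?m k + 2 * \<alpha> + 2) * c k / (4 * real (Suc n)) * cos ((?m k + 1) * t)"
  let ?b = "\<lambda>k. (2 * \<alpha> + 2 - ?m k) * c k / (4 * real (Suc n)) * cos ((?m k - 1) * t)"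
  have "poly (rodrigues_poly (Suc n) \<alpha>) (cos t)
     = - 1 / (2 * real (Suc n)) * ((1 - (cos t)\<^sup>2) * poly (pderiv ?p) (cos t) - 2 * (\<alpha> + 1) * cos t * poly ?p (cos t))"
    by (simp add: power2_eq_square algebra_simps)
  also have "\<dots> = (\<Sum>k\<le>n. - 1 / (2 * real (Suc n)) *
      (c k * ?m k * (sin (?m k * t) * sin t) - 2 * (\<alpha> + 1) * cos t * (c k * cos (?m k * t))))"
    unfolding pd unfolding p' by (simp only: sum_distrib_left[symmetric] sum_subtractf)
  also have "\<dots> = (\<Sum>k\<le>n. ?a k + ?b k)"
  proof (rule sum.cong[OF refl])
    fix k
    have 1: "cos ((?m k + 1) * t) = cos (?m k * t) * cos t - sin (?m k * t) * sin t"
      using cos_add[of "?m k * t" t] by (simp add: ring_distribs)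
    have 2: "cos ((?m k - 1) * t) = cos (?m k * t) * cos t + sin (?m k * t) * sin t"
      using cos_diff[of "?m k * t" t] by (simp add: ring_distribs)
    have "- 1 / (2 * N) * (C * m * (S * s) - 2 * (\<alpha> + 1) * T * (C * K))
       = (m + 2 * \<alpha> + 2) * C / (4 * N) * (K * T - S * s) + (2 * \<alpha> + 2 - m) * C / (4 * N) * (K * T + S * s)"
      if "N > 0" for N C m S s T K :: real
      using that by (simp add: field_simps)
    then show "- 1 / (2 * real (Suc n)) *
      (c k * ?m k * (sin (?m k * t) * sin t) - 2 * (\<alpha> + 1) * cos t * (c k * cos (?m k * t))) = ?a k + ?b k"
      unfolding 1 2 by (metis of_nat_0_less_iff zero_less_Suc)
  qed
  also have "\<dots> = (\<Sum>k\<le>n. ?a k) + (\<Sum>k\<le>n. ?b k)" by (rule sum.distrib)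
  also have "(\<Sum>k\<le>n. ?a k) = ?a 0 + (\<Sum>k<n. ?a (Suc k))"
    by (simp only: sum.atMost_shift)
  also have "(\<Sum>k\<le>n. ?b k) = (\<Sum>k<n. ?b k) + ?b n"
    by (simp only: lessThan_Suc_atMost[symmetric] sum.lessThan_Suc)
  also have "?a 0 + (\<Sum>k<n. ?a (Suc k)) + ((\<Sum>k<n. ?b k) + ?b n) = ?a 0 + (\<Sum>k<n. ?a (Suc k) + ?b k) + ?b n"
    by (simp add: sum.distrib)
  also have "?a 0 = d 0 * cos ((real (Suc n) - 2 * real 0) * t)"
    unfolding d0 by (simp add: algebra_simps)
  also have "?b n = d (Suc n) * cos ((real (Suc n) - 2 * real (Suc n)) * t)"
  proof -
    have e: "real n - 2 * real n - 1 = real (Suc n) - 2 * real (Suc n)" by simp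
    show ?thesis unfolding dn e by (simp add: algebra_simps del: of_nat_Suc)
  qed
  also have "(\<Sum>k<n. ?a (Suc k) + ?b k) = (\<Sum>k<n. d (Suc k) * cos ((real (Suc n) - 2 * real (Suc k)) * t))"
  proof (rule sum.cong[OF refl])
    fix k assume "k \<in> {..<n}"
    then have k: "k < n" by simp
    have e: "?m (Suc k) + 1 = real (Suc n) - 2 * real (Suc k)" "?m k - 1 = real (Suc n) - 2 * real (Suc k)"
      by auto
    show "?a (Suc k) + ?b k = d (Suc k) * cos ((real (Suc n) - 2 * real (Suc k)) * t)"
      unfolding e dk[OF k] by (simp only: distrib_right[symmetric] add_divide_distrib[symmetric]) (simp add: algebra_simps)
  qed
  finally show "poly (rodrigues_poly (Suc n) \<alpha>) (cos t) = (\<Sum>k\<le>Suc n. d k * cos ((real (Suc n) - 2 * real k) * t))"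
    by (simp only: sum.atMost_shift sum.lessThan_Suc add.assoc)
qed

text \<open>Above -1, the only nonpositive integer is 0; this is why \<alpha> = -1/2 is the single
  exceptional parameter.\<close>

lemma two_alpha_plus_1_not_pole:
  fixes \<alpha> :: real
  assumes "\<alpha> > -1" "\<alpha> \<noteq> -1/2"
  shows "2 * \<alpha> + 1 \<notin> \<int>\<^sub>\<le>\<^sub>0"
proof
  assume "2 * \<alpha> + 1 \<in> \<int>\<^sub>\<le>\<^sub>0"
  then obtain m :: nat where "2 * \<alpha> + 1 = - real m" by (elim nonpos_Ints_cases')
  then show False using assms by (cases m) auto
qed

lemma gegenbauer_g_pochhammer:
  assumes "\<alpha> > -1" "\<alpha> \<noteq> -1/2"
  shows "gegenbauer_g \<alpha> n k = pochhammer (\<alpha> + 1/2) k / fact k"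
proof -
  have "\<alpha> + 1/2 \<notin> \<int>\<^sub>\<le>\<^sub>0"
  proof
    assume "\<alpha> + 1/2 \<in> \<int>\<^sub>\<le>\<^sub>0"
    then obtain m :: nat where "\<alpha> + 1/2 = - real m" by (elim nonpos_Ints_cases')
    then show False using assms by (cases m) auto
  qed
  from pochhammer_Gamma[OF this, of k] have "pochhammer (\<alpha> + 1/2) k = Gamma (real k + \<alpha> + 1/2) / Gamma (\<alpha> + 1/2)"
    by (simp add: add_ac)
  moreover have "Gamma (\<alpha> + 1/2) \<noteq> 0" using \<open>\<alpha> + 1/2 \<notin> \<int>\<^sub>\<le>\<^sub>0\<close> by (simp add: Gamma_eq_zero_iff)
  ultimately show ?thesis using assms by (auto simp: gegenbauer_g_def)
qed

text \<open>Compares the constants at the two ends of one step of \<open>rodrigues_poly\<close>, by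
  the functional equation of Gamma.\<close>

lemma gegenbauer_A_Suc:
  assumes "\<alpha> > -1" "\<alpha> \<noteq> -1/2"
  shows "gegenbauer_A \<alpha> (Suc n) = (real n + 2 * \<alpha> + 2) / (2 * (2 * \<alpha> + 1)) * gegenbauer_A (\<alpha> + 1) n"
proof -
  have G1: "Gamma (2 * \<alpha> + 3) = (2 * \<alpha> + 2) * (2 * \<alpha> + 1) * Gamma (2 * \<alpha> + 1)"
  proof -
    have "2 * \<alpha> + 1 \<notin> \<int>\<^sub>\<le>\<^sub>0"
    by (rule two_alpha_plus_1_not_pole[OF assms])
    from Gamma_plus1[OF this] have 1: "Gamma (2 * \<alpha> + 2) = (2 * \<alpha> + 1) * Gamma (2 * \<alpha> + 1)"
      by (simp add: add_ac)
    have "2 * \<alpha> + 2 \<notin> \<int>\<^sub>\<le>\<^sub>0" using assms by (auto elim!: nonpos_Ints_cases)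
    from Gamma_plus1[OF this] 1 show ?thesis by (simp add: add_ac)
  qed
  have "\<alpha> + 1 \<notin> \<int>\<^sub>\<le>\<^sub>0" using assms by (auto elim!: nonpos_Ints_cases)
  from Gamma_plus1[OF this] have G2: "Gamma (\<alpha> + 2) = (\<alpha> + 1) * Gamma (\<alpha> + 1)" by (simp add: add_ac)
  have "real n + 2 * \<alpha> + 2 \<notin> \<int>\<^sub>\<le>\<^sub>0" using assms by (auto elim!: nonpos_Ints_cases)
  from Gamma_plus1[OF this] have G3: "Gamma (real n + 2 * \<alpha> + 3) = (real n + 2 * \<alpha> + 2) * Gamma (real n + 2 * \<alpha> + 2)"
    by (simp add: add_ac)
  have pos: "Gamma (real n + 2 * \<alpha> + 2) > 0" "Gamma (\<alpha> + 1) > 0" "real n + 2 * \<alpha> + 2 > 0" "\<alpha> + 1 > 0"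
    using assms by (auto intro!: Gamma_real_pos)
  have A1: "gegenbauer_A \<alpha> (Suc n) = Gamma (2 * \<alpha> + 1) * Gamma (real n + \<alpha> + 2) / (Gamma (\<alpha> + 1) * Gamma (real n + 2 * \<alpha> + 2))"
    using assms by (simp add: gegenbauer_A_def add_ac)
  have A2: "gegenbauer_A (\<alpha> + 1) n = Gamma (2 * \<alpha> + 3) * Gamma (real n + \<alpha> + 2) / (Gamma (\<alpha> + 2) * Gamma (real n + 2 * \<alpha> + 3))"
    using assms by (simp add: gegenbauer_A_def add_ac algebra_simps)
  have "2 * \<alpha> + 1 \<noteq> 0" using assms by auto
  moreover have "(s * (2 * a * b) * y / (a * x * (w * z))) = 2 * (b * s * y) / (x * (w * z))" if "a \<noteq> 0" for a b s x y z w :: real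
    using that by (simp add: field_simps)
  ultimately show ?thesis unfolding A1 A2 G1 G2 G3 using pos
    by (simp add: divide_simps) (simp add: algebra_simps)
qed

text \<open>The exceptional counterpart of \<open>gegenbauer_A_Suc\<close>, whose denominator 2
  \<alpha> + 1 vanishes here.\<close>

lemma gegenbauer_A_half: "gegenbauer_A (-1/2) (Suc n) = gegenbauer_A (1/2) n / 4"
proof -
  have "Gamma (3/2 :: real) = sqrt pi / 2"
    using Gamma_plus1[of "1/2::real"] Gamma_one_half_real by (fastforce elim!: nonpos_Ints_cases' simp: add_ac)
  moreover have "Gamma (2::real) = 1" using Gamma_fact[of 1, where ?'a=real] by simp
  moreover have "Gamma (real n + 2) = fact (Suc n)" using Gamma_fact[of "Suc n", where ?'a=real] by (simp add: add_ac)
  ultimately show ?thesis by (simp add: gegenbauer_A_def add_ac)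
qed

text \<open>With l = \<alpha> + 1/2, the products of two \<open>gegenbauer_g\<close> are the
  classical cosine coefficients of the Gegenbauer polynomial with parameter l, and
  \<open>gegenbauer_A\<close> converts its normalization. The induction never meets -1/2, since
  \<alpha> + 1 > 0.\<close>

lemma gegenbauer_cos_coeffs_ne:
  assumes "\<alpha> > -1" "\<alpha> \<noteq> -1/2"
  shows "has_cos_coeffs (rodrigues_poly n \<alpha>) n (\<lambda>k. gegenbauer_A \<alpha> n * gegenbauer_g \<alpha> n k * gegenbauer_g \<alpha> n (n - k))"
  using assms
proof (induction n arbitrary: \<alpha>)
  case 0
  have "2 * \<alpha> + 1 \<notin> \<int>\<^sub>\<le>\<^sub>0"
    by (rule two_alpha_plus_1_not_pole[OF 0])
  then have "Gamma (2 * \<alpha> + 1) \<noteq> 0" by (simp add: Gamma_eq_zero_iff)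
  moreover have "\<alpha> + 1 > 0" using 0 by simp
  then have "Gamma (\<alpha> + 1) \<noteq> 0" using Gamma_real_pos[of "\<alpha> + 1"] by (metis less_irrefl)
  ultimately show ?case using 0 by (simp add: has_cos_coeffs_def gegenbauer_A_def gegenbauer_g_def)
next
  case (Suc n)
  define l where "l = \<alpha> + 1/2"
  have l: "l \<noteq> 0" "2 * \<alpha> + 1 = 2 * l" using Suc.prems by (auto simp: l_def)
  define G where "G k = pochhammer l k / fact k" for k
  define H where "H k = pochhammer (l + 1) k / fact k" for k
  have H: "H k = (l + real k) / l * G k" for k
  proof -
    have "l * pochhammer (l + 1) k = pochhammer l k * (l + real k)"
      using pochhammer_rec[of l k] pochhammer_rec'[of l k] by (simp add: mult_ac)
    then show ?thesis using l(1) by (simp add: G_def H_def field_simps)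
  qed
  have G_Suc: "H k = real (Suc k) / l * G (Suc k)" for k
    using l(1) pochhammer_rec[of l k] by (simp add: G_def H_def field_simps del: of_nat_Suc)
  have g: "gegenbauer_g \<alpha> m k = G k" for m k
    using gegenbauer_g_pochhammer[OF Suc.prems] by (simp add: G_def l_def)
  have h: "gegenbauer_g (\<alpha> + 1) m k = H k" for m k
    using gegenbauer_g_pochhammer[of "\<alpha> + 1"] Suc.prems by (simp add: H_def l_def add_ac)
  define A where "A = gegenbauer_A (\<alpha> + 1) n"
  have A: "gegenbauer_A \<alpha> (Suc n) = (real (Suc n) + 2 * l) / (4 * l) * A"
    using gegenbauer_A_Suc[OF Suc.prems, of n] l by (simp add: A_def l_def algebra_simps)
  have "has_cos_coeffs (rodrigues_poly n (\<alpha> + 1)) n (\<lambda>k. A * H k * H (n - k))"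
    using Suc.IH[of "\<alpha> + 1"] Suc.prems by (simp add: h A_def)
  then have "has_cos_coeffs (rodrigues_poly (Suc n) \<alpha>) (Suc n)
      (\<lambda>k. (real (Suc n) + 2 * l) / (4 * l) * A * G k * G (Suc n - k))"
  proof (rule has_cos_coeffs_rodrigues_Suc)
    have 0: "H 0 = 1" "G 0 = 1" by (simp_all add: H_def G_def)
    have e: "real n + 2 * \<alpha> + 2 = real (Suc n) + 2 * l" by (simp add: l_def)
    then show "(real (Suc n) + 2 * l) / (4 * l) * A * G 0 * G (Suc n - 0) = (real n + 2 * \<alpha> + 2) / (4 * real (Suc n)) * (A * H 0 * H (n - 0))"
      "(real (Suc n) + 2 * l) / (4 * l) * A * G (Suc n) * G (Suc n - Suc n) = (real n + 2 * \<alpha> + 2) / (4 * real (Suc n)) * (A * H n * H (n - n))"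
      unfolding e using l(1) 0 by (simp_all add: G_Suc[of n] field_simps del: of_nat_Suc)
  next
    fix k assume k: "k < n"
    \<comment> \<open>The two indices of the target coefficient, with a + b = n + 1. All four values
      of \<open>H\<close> are reduced to \<open>G (Suc k)\<close> and \<open>G (n - k)\<close>;
      \<open>key\<close> then merges the two shares.\<close>
    define a where "a = real (Suc k)"
    define b where "b = real (n - k)"
    have ab: "real (Suc n) = a + b" "a > 0" "b > 0" using k by (auto simp: a_def b_def)
    have H1: "H (Suc k) = (l + a) / l * G (Suc k)" using H[of "Suc k"] by (simp add: a_def)
    have H2: "H (n - Suc k) = b / l * G (n - k)" using G_Suc[of "n - Suc k"] k by (simp add: b_def Suc_diff_Suc)
    have H3: "H k = a / l * G (Suc k)" using G_Suc[of k] by (simp add: a_def)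
    have H4: "H (n - k) = (l + b) / l * G (n - k)" using H[of "n - k"] by (simp add: b_def)
    have n: "real n - 2 * real (Suc k) + 2 * \<alpha> + 2 = b - a + 2 * l"
       "2 * \<alpha> + 2 - real n + 2 * real k = 2 * l + a - b"
      using k by (simp_all add: a_def b_def l_def of_nat_diff)
    have key: "(b - a + 2 * l) * ((l + a) * b) + (2 * l + a - b) * (a * (l + b)) = l * (a + b) * (a + b + 2 * l)"
      by (simp add: algebra_simps)
    have "((b - a + 2 * l) * (A * ((l + a) / l * X) * (b / l * Y)) + (2 * l + a - b) * (A * (a / l * X) * ((l + b) / l * Y))) / (4 * (a + b))
       = ((b - a + 2 * l) * ((l + a) * b) + (2 * l + a - b) * (a * (l + b))) * (A * X * Y) / (l * l * (4 * (a + b)))" for X Y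
      using l(1) ab by (simp add: divide_simps) (simp add: algebra_simps)
    also have "\<dots> X Y = (a + b + 2 * l) / (4 * l) * A * X * Y" for X Y
      unfolding key using l(1) ab by (simp add: divide_simps)
    finally show "(real (Suc n) + 2 * l) / (4 * l) * A * G (Suc k) * G (Suc n - Suc k) =
      ((real n - 2 * real (Suc k) + 2 * \<alpha> + 2) * (A * H (Suc k) * H (n - Suc k)) +
       (2 * \<alpha> + 2 - real n + 2 * real k) * (A * H k * H (n - k))) / (4 * real (Suc n))"
      unfolding n H1 H2 H3 H4 ab by simp
  qed
  then show ?case by (simp add: g A del: rodrigues_poly.simps of_nat_Suc)
qed

text \<open>At \<alpha> = -1/2 the last step starts from 1/2, where all g are 1. With equal
  coefficients the two shares cancel at every inner index, so only k = 0 and k = n survive: a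
  multiple of T_n. The bound n >= 1 matters, as the formula at -1/2 would give 1/2 instead of 1 for
  n = 0.\<close>

lemma gegenbauer_cos_coeffs:
  assumes "\<alpha> > -1" "n \<ge> 1"
  shows "has_cos_coeffs (rodrigues_poly n \<alpha>) n (\<lambda>k. gegenbauer_A \<alpha> n * gegenbauer_g \<alpha> n k * gegenbauer_g \<alpha> n (n - k))"
proof (cases "\<alpha> = -1/2")
  case False
  then show ?thesis using gegenbauer_cos_coeffs_ne assms by blast
next
  case True
  obtain m where n: "n = Suc m" using assms(2) by (cases n) auto
  have g: "gegenbauer_g (1/2) m k = 1" for k
    using gegenbauer_g_pochhammer[of "1/2" m k] by (simp add: pochhammer_fact[symmetric])
  have "has_cos_coeffs (rodrigues_poly m (\<alpha> + 1)) m (\<lambda>k. gegenbauer_A (1/2) m)"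
    using gegenbauer_cos_coeffs_ne[of "1/2" m] True by (simp add: g)
  note coeffs = this
  have half: "gegenbauer_A (- (1/2)) (Suc m) = gegenbauer_A (1/2) m / 4"
    using gegenbauer_A_half[of m] by simp
  from coeffs show ?thesis unfolding n
    by (rule has_cos_coeffs_rodrigues_Suc)
       (simp_all add: True half gegenbauer_g_def, simp_all add: divide_simps algebra_simps)
qed

section \<open>Quadrature remainders of Chebyshev polynomials\<close>

text \<open>The reflection k -> n - k negates each sine and keeps its coefficient. This removes the
  unwanted part of sin(a + b) in the product with U.\<close>

lemma sum_sin_symmetric:
  fixes c :: "nat \<Rightarrow> real"
  assumes "\<And>k. k \<le> n \<Longrightarrow> c (n - k) = c k"
  shows "(\<Sum>k\<le>n. c k * sin ((real n - 2 * real k) * t)) = 0"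
proof -
  let ?S = "\<Sum>k\<le>n. c k * sin ((real n - 2 * real k) * t)"
  have "?S = (\<Sum>k\<le>n. - (c k * sin ((real n - 2 * real k) * t)))"
  proof (rule sum.reindex_bij_witness[of _ "\<lambda>k. n - k" "\<lambda>k. n - k"])
    fix k assume "k \<in> {..n}"
    then have "k \<le> n" by simp
    then have "(real n - 2 * real (n - k)) * t = - ((real n - 2 * real k) * t)"
      by (simp add: of_nat_diff algebra_simps)
    then show "- (c (n - k) * sin ((real n - 2 * real (n - k)) * t)) = c k * sin ((real n - 2 * real k) * t)"
      using assms[OF \<open>k \<le> n\<close>] by simp
  qed auto
  also have "\<dots> = - ?S" by (rule sum_negf)
  finally show ?thesis by simp
qed

text \<open>Expand sin(a + b) for a = (n + m + 1) t and b = (n - 2k) t: the terms sin a cos b sum up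
  to the product on the left, and the terms cos a sin b cancel by symmetry.\<close>

lemma chebyshev_U_mult_has_cos_coeffs:
  assumes p: "has_cos_coeffs p n c" and c: "\<And>k. k \<le> n \<Longrightarrow> c (n - k) = c k"
  shows "chebyshev_U (n + m) * p = (\<Sum>k\<le>n. smult (c k) (chebyshev_U (2 * n + m - 2 * k)))"
proof (rule poly_eq_on_interval)
  fix x :: real assume "x \<in> {-1<..<1}"
  then obtain t where t: "x = cos t" "sin t > 0" by (rule interval_cosE)
  let ?a = "real (n + m + 1) * t"
  have "poly (\<Sum>k\<le>n. smult (c k) (chebyshev_U (2 * n + m - 2 * k))) x * sin t
     = (\<Sum>k\<le>n. c k * (poly (chebyshev_U (2 * n + m - 2 * k)) (cos t) * sin t))"
    by (simp add: poly_sum sum_distrib_right t mult.assoc)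
  also have "\<dots> = (\<Sum>k\<le>n. sin ?a * (c k * cos ((real n - 2 * real k) * t)) + cos ?a * (c k * sin ((real n - 2 * real k) * t)))"
  proof (rule sum.cong[OF refl])
    fix k assume "k \<in> {..n}"
    then have "real (2 * n + m - 2 * k + 1) * t = ?a + (real n - 2 * real k) * t"
      by (simp add: of_nat_diff algebra_simps)
    then show "c k * (poly (chebyshev_U (2 * n + m - 2 * k)) (cos t) * sin t)
      = sin ?a * (c k * cos ((real n - 2 * real k) * t)) + cos ?a * (c k * sin ((real n - 2 * real k) * t))"
      unfolding chebyshev_U_cos by (simp only: sin_add) (simp add: algebra_simps)
  qed
  also have "\<dots> = sin ?a * poly p (cos t) + cos ?a * (\<Sum>k\<le>n. c k * sin ((real n - 2 * real k) * t))"
    using p by (simp add: has_cos_coeffs_def sum.distrib sum_distrib_left)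
  also have "\<dots> = sin ?a * poly p (cos t)" using sum_sin_symmetric[of n c t, OF c] by simp
  also have "\<dots> = poly (chebyshev_U (n + m) * p) x * sin t"
    unfolding chebyshev_U_cos[symmetric] by (simp add: t)
  finally show "poly (chebyshev_U (n + m) * p) x = poly (\<Sum>k\<le>n. smult (c k) (chebyshev_U (2 * n + m - 2 * k))) x"
    using t by simp
qed

text \<open>The linear system for the remainders. Even m leads to the recursion of
  \<open>gegenbauer_mu\<close>, odd m to the vanishing of the odd remainders.\<close>

lemma poly_remainder_chebyshev_U_sum:
  assumes "\<alpha> > -1" "n \<ge> 1"
  shows "(\<Sum>k\<le>n. gegenbauer_A \<alpha> n * gegenbauer_g \<alpha> n k * gegenbauer_g \<alpha> n (n - k)
             * poly_remainder \<alpha> n (chebyshev_U (2 * n + m - 2 * k)))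
       = jacobi_norm \<alpha> n * gegenbauer_sigma \<alpha> n m"
proof -
  let ?c = "\<lambda>k. gegenbauer_A \<alpha> n * gegenbauer_g \<alpha> n k * gegenbauer_g \<alpha> n (n - k)"
  have "chebyshev_U (n + m) * jacobi_poly \<alpha> n = (\<Sum>k\<le>n. smult (?c k) (chebyshev_U (2 * n + m - 2 * k)))"
    unfolding jacobi_poly_eq_rodrigues_poly
    by (rule chebyshev_U_mult_has_cos_coeffs[OF gegenbauer_cos_coeffs[OF assms]]) simp
  then have "(\<Sum>k\<le>n. ?c k * poly_remainder \<alpha> n (chebyshev_U (2 * n + m - 2 * k)))
      = poly_remainder \<alpha> n (chebyshev_U (n + m) * jacobi_poly \<alpha> n)"
    by (simp add: poly_remainder_sum[OF assms(1)] poly_remainder_smult)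
  also have "\<dots> = jacobi_norm \<alpha> n * gegenbauer_sigma \<alpha> n m"
    unfolding poly_remainder_jacobi_mult gegenbauer_sigma_def
    using jacobi_norm_pos[OF assms(1), of n] by simp
  finally show ?thesis .
qed

section \<open>Solving the triangular system\<close>

lemma gegenbauer_g_0: "gegenbauer_g \<alpha> n 0 = 1"
  by (simp add: gegenbauer_g_def)

lemma gegenbauer_g_nonzero:
  assumes "\<alpha> > -1" shows "gegenbauer_g \<alpha> n n \<noteq> 0"
proof (cases "\<alpha> = -1/2")
  case False
  have "\<alpha> + 1/2 \<noteq> - real k" for k using assms False by (cases k) auto
  then show ?thesis
    using gegenbauer_g_pochhammer[OF assms False, of n n] by (simp add: pochhammer_eq_0_iff)
qed (simp add: gegenbauer_g_def)

lemma gegenbauer_A_nonzero: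
  assumes "\<alpha> > -1" "n \<ge> 1" shows "gegenbauer_A \<alpha> n \<noteq> 0"
proof (cases "\<alpha> = -1/2")
  case True
  have "Gamma (real n + 1/2) > 0" by (rule Gamma_real_pos) (use assms in simp)
  then have "Gamma (real n + 1/2) \<noteq> 0" by (rule less_imp_neq[THEN not_sym])
  then show ?thesis using True assms(2) by (simp add: gegenbauer_A_def)
next
  case False
  have "2 * \<alpha> + 1 \<notin> \<int>\<^sub>\<le>\<^sub>0"
    using two_alpha_plus_1_not_pole assms(1) False by blast
  then have "Gamma (2 * \<alpha> + 1) \<noteq> 0" by (simp add: Gamma_eq_zero_iff)
  moreover have "Gamma (real n + \<alpha> + 1) > 0" "Gamma (\<alpha> + 1) > 0" "Gamma (real n + 2 * \<alpha> + 1) > 0"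
    using assms by (auto intro!: Gamma_real_pos)
  ultimately show ?thesis using False by (simp add: gegenbauer_A_def)
qed

lemma gegenbauer_mu_eq_remainder:
  assumes "\<alpha> > -1" "n \<ge> 1"
  shows "jacobi_norm \<alpha> n * gegenbauer_mu \<alpha> n l = poly_remainder \<alpha> n (chebyshev_U (2 * n + 2 * l))"
proof (induction l rule: less_induct)
  case (less l)
  let ?A = "gegenbauer_A \<alpha> n" and ?g = "gegenbauer_g \<alpha> n" and ?\<gamma> = "jacobi_norm \<alpha> n"
  let ?R = "\<lambda>j. poly_remainder \<alpha> n (chebyshev_U j)"
  have nz: "?A \<noteq> 0" "?g n \<noteq> 0" using gegenbauer_A_nonzero gegenbauer_g_nonzero assms by auto
  let ?S = "\<Sum>k=1..min n l. ?g k * ?g (n - k) * gegenbauer_mu \<alpha> n (l - k)"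
  have "?\<gamma> * gegenbauer_sigma \<alpha> n (2 * l) = (\<Sum>k\<le>n. ?A * ?g k * ?g (n - k) * ?R (2 * n + 2 * l - 2 * k))"
    using poly_remainder_chebyshev_U_sum[OF assms, of "2 * l"] by simp
  \<comment> \<open>For k > l the degree 2n + 2l - 2k is below 2n and the rule is exact; this is the
    origin of the upper limit min n l.\<close>
  also have "\<dots> = (\<Sum>k\<le>min n l. ?A * ?g k * ?g (n - k) * ?R (2 * n + 2 * l - 2 * k))"
  proof (rule sum.mono_neutral_right)
    show "\<forall>k\<in>{..n} - {..min n l}. ?A * ?g k * ?g (n - k) * ?R (2 * n + 2 * l - 2 * k) = 0"
    proof
      fix k assume "k \<in> {..n} - {..min n l}"
      then have "degree (chebyshev_U (2 * n + 2 * l - 2 * k)) < 2 * n"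
        by (intro le_less_trans[OF degree_chebyshev_U_le]) auto
      then show "?A * ?g k * ?g (n - k) * ?R (2 * n + 2 * l - 2 * k) = 0"
        using poly_remainder_exact[OF assms(1)] by simp
    qed
  qed auto
  also have "\<dots> = ?A * ?g n * ?R (2 * n + 2 * l) + (\<Sum>k=1..min n l. ?A * ?g k * ?g (n - k) * ?R (2 * n + 2 * l - 2 * k))"
    by (simp add: atMost_atLeast0 sum.atLeast_Suc_atMost gegenbauer_g_0)
  also have "(\<Sum>k=1..min n l. ?A * ?g k * ?g (n - k) * ?R (2 * n + 2 * l - 2 * k)) = (\<Sum>k=1..min n l. ?A * ?\<gamma> * (?g k * ?g (n - k) * gegenbauer_mu \<alpha> n (l - k)))"
  proof (rule sum.cong[OF refl])
    fix k assume k: "k \<in> {1..min n l}"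
    then have "2 * n + 2 * l - 2 * k = 2 * n + 2 * (l - k)" by auto
    moreover have "?\<gamma> * gegenbauer_mu \<alpha> n (l - k) = ?R (2 * n + 2 * (l - k))" using k by (intro less) auto
    ultimately show "?A * ?g k * ?g (n - k) * ?R (2 * n + 2 * l - 2 * k) = ?A * ?\<gamma> * (?g k * ?g (n - k) * gegenbauer_mu \<alpha> n (l - k))"
      by (simp add: mult_ac)
  qed
  also have "\<dots> = ?A * ?\<gamma> * ?S" by (simp only: sum_distrib_left)
  finally have eq: "?\<gamma> * gegenbauer_sigma \<alpha> n (2 * l) = ?A * ?g n * ?R (2 * n + 2 * l) + ?A * ?\<gamma> * ?S" .
  \<comment> \<open>For l = 0 the sum is empty, so one formula covers both branches of the
    recursion.\<close>
  have mu: "gegenbauer_mu \<alpha> n l = 1 / ?g n * (gegenbauer_sigma \<alpha> n (2 * l) / ?A - ?S)"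
    by (subst gegenbauer_mu.simps) (auto simp: field_simps)
  have "?A * ?g n * (?\<gamma> * gegenbauer_mu \<alpha> n l) = ?\<gamma> * gegenbauer_sigma \<alpha> n (2 * l) - ?A * ?\<gamma> * ?S"
    unfolding mu using nz by (simp add: field_simps)
  also have "\<dots> = ?A * ?g n * ?R (2 * n + 2 * l)" unfolding eq by simp
  finally show ?case using nz by simp
qed

section \<open>Parity and the odd degrees\<close>

lemma poly_pderiv_reflect:
  fixes p :: "real poly"
  assumes "\<And>x. poly p (- x) = s * poly p x"
  shows "poly (pderiv p) (- x) = - s * poly (pderiv p) x"
proof -
  have "((\<lambda>x. poly p (- x)) has_real_derivative poly (pderiv p) (- x) * (- 1)) (at x)"
    by (rule DERIV_chain2[OF poly_DERIV]) (auto intro!: derivative_eq_intros)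
  moreover have "((\<lambda>x. poly p (- x)) has_real_derivative s * poly (pderiv p) x) (at x)"
    unfolding assms by (intro DERIV_cmult poly_DERIV)
  ultimately show ?thesis using DERIV_unique by fastforce
qed

lemma rodrigues_poly_reflect: "poly (rodrigues_poly n \<alpha>) (- x) = (-1) ^ n * poly (rodrigues_poly n \<alpha>) x"
proof (induction n arbitrary: \<alpha> x)
  case (Suc n)
  show ?case using Suc.IH[of "\<alpha> + 1" x] poly_pderiv_reflect[OF Suc.IH, of "\<alpha> + 1" x]
    by (simp add: field_simps)
qed simp

lemma chebyshev_U_reflect: "poly (chebyshev_U k) (- x) = (-1) ^ k * poly (chebyshev_U k) x"
  by (induction k rule: chebyshev_U.induct) (auto simp: algebra_simps)

lemma set_integral_odd_zero:
  fixes f :: "real \<Rightarrow> real"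
  assumes "\<And>x. f (- x) = - f x"
  shows "(LBINT x:{-1<..<1}. f x) = 0"
proof -
  let ?h = "\<lambda>x. indicator {-1<..<1} x *\<^sub>R f x"
  have "(LINT x|lborel. ?h x) = (LINT x|lborel. ?h (- x))"
    using lborel_integral_real_affine[of "-1" ?h 0] by simp
  also have "\<dots> = (LINT x|lborel. - ?h x)"
    by (intro Bochner_Integration.integral_cong) (auto simp: assms indicator_def)
  finally show ?thesis unfolding set_lebesgue_integral_def by simp
qed

lemma gegenbauer_sigma_odd:
  assumes "odd m"
  shows "gegenbauer_sigma \<alpha> n m = 0"
proof -
  have "(-1) ^ (n + m) * (-1) ^ n = (-1 :: real)"
    using assms by (simp add: uminus_power_if)
  then have "(LBINT x:{-1<..<1}. poly (chebyshev_U (n + m)) x * poly (jacobi_poly \<alpha> n) x * gegenbauer_weight \<alpha> x) = 0"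
    by (intro set_integral_odd_zero)
      (simp add: jacobi_poly_eq_rodrigues_poly rodrigues_poly_reflect chebyshev_U_reflect gegenbauer_weight_def uminus_power_if assms)
  then show ?thesis by (simp add: gegenbauer_sigma_def)
qed

text \<open>The linear system with right-hand side 0: for k >= 1 the terms vanish by induction (k <=
  l) or by exactness (k > l), which leaves the term k = 0 with a nonzero coefficient.\<close>

lemma poly_remainder_chebyshev_U_odd:
  assumes "\<alpha> > -1" "n \<ge> 1"
  shows "poly_remainder \<alpha> n (chebyshev_U (2 * n + 2 * l + 1)) = 0"
proof (induction l rule: less_induct)
  case (less l)
  let ?A = "gegenbauer_A \<alpha> n" and ?g = "gegenbauer_g \<alpha> n"
  let ?R = "\<lambda>j. poly_remainder \<alpha> n (chebyshev_U j)"
  let ?f = "\<lambda>k. ?A * ?g k * ?g (n - k) * ?R (2 * n + (2 * l + 1) - 2 * k)"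
  have "?f k = 0" if "k \<in> {1..n}" for k
  proof (cases "k \<le> l")
    case True
    then have "2 * n + (2 * l + 1) - 2 * k = 2 * n + 2 * (l - k) + 1" by auto
    moreover have "?R (2 * n + 2 * (l - k) + 1) = 0" using that True by (intro less) auto
    ultimately show ?thesis by (simp only: mult_zero_right)
  next
    case False
    then have "degree (chebyshev_U (2 * n + (2 * l + 1) - 2 * k)) < 2 * n"
      using that assms(2) by (intro le_less_trans[OF degree_chebyshev_U_le]) auto
    then show ?thesis using poly_remainder_exact[OF assms(1)] by simp
  qed
  then have "(\<Sum>k=1..n. ?f k) = 0" by (intro sum.neutral) auto
  moreover have "(\<Sum>k\<le>n. ?f k) = ?f 0 + (\<Sum>k=1..n. ?f k)"
    by (simp add: atMost_atLeast0 sum.atLeast_Suc_atMost)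
  moreover have "(\<Sum>k\<le>n. ?f k) = 0"
    using poly_remainder_chebyshev_U_sum[OF assms, of "2 * l + 1"] gegenbauer_sigma_odd[of "2 * l + 1" \<alpha> n] by simp
  ultimately have "?f 0 = 0" by simp
  then show ?case using gegenbauer_A_nonzero[OF assms] gegenbauer_g_nonzero[OF assms(1), of n] by (simp add: gegenbauer_g_0)
qed

section \<open>Remainders of the Chebyshev polynomials of the first kind\<close>

lemma poly_remainder_chebyshev_T_Suc_Suc:
  assumes "\<alpha> > -1"
  shows "poly_remainder \<alpha> n (chebyshev_T (Suc (Suc k)))
    = (poly_remainder \<alpha> n (chebyshev_U (Suc (Suc k))) - poly_remainder \<alpha> n (chebyshev_U k)) / 2"
  by (simp add: poly_remainder_smult poly_remainder_diff[OF assms] del: chebyshev_U.simps)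

lemma poly_remainder_chebyshev_T_odd:
  assumes "\<alpha> > -1" "n \<ge> 1"
  shows "poly_remainder \<alpha> n (chebyshev_T (2 * n + 2 * l + 1)) = 0"
proof -
  obtain k where k: "2 * n + 2 * l + 1 = Suc (Suc k)" using assms(2) by (cases n) auto
  have "poly_remainder \<alpha> n (chebyshev_U k) = 0"
  proof (cases l)
    case 0
    then have "degree (chebyshev_U k) < 2 * n"
      using k by (intro le_less_trans[OF degree_chebyshev_U_le]) auto
    then show ?thesis using poly_remainder_exact[OF assms(1)] by simp
  next
    case (Suc j)
    then have "k = 2 * n + 2 * j + 1" using k by simp
    then show ?thesis using poly_remainder_chebyshev_U_odd[OF assms] by simp
  qed
  moreover have "poly_remainder \<alpha> n (chebyshev_U (Suc (Suc k))) = 0"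
    using poly_remainder_chebyshev_U_odd[OF assms, of l] unfolding k .
  ultimately show ?thesis unfolding k poly_remainder_chebyshev_T_Suc_Suc[OF assms(1)] by simp
qed

text \<open>The partner U_{2n-2} is integrated exactly, so the leading term carries \<mu> itself and
  not a difference; it produces the separate summand in the final bound.\<close>

lemma poly_remainder_chebyshev_T_0:
  assumes "\<alpha> > -1" "n \<ge> 1"
  shows "poly_remainder \<alpha> n (chebyshev_T (2 * n)) = jacobi_norm \<alpha> n * gegenbauer_mu \<alpha> n 0 / 2"
proof -
  obtain k where k: "2 * n = Suc (Suc k)" using assms(2) by (cases n) auto
  have "degree (chebyshev_U k) < 2 * n"
    using k by (intro le_less_trans[OF degree_chebyshev_U_le]) auto
  then have "poly_remainder \<alpha> n (chebyshev_U k) = 0" by (rule poly_remainder_exact[OF assms(1)])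
  moreover have "poly_remainder \<alpha> n (chebyshev_U (Suc (Suc k))) = jacobi_norm \<alpha> n * gegenbauer_mu \<alpha> n 0"
    using gegenbauer_mu_eq_remainder[OF assms, of 0] k by simp
  ultimately show ?thesis unfolding k poly_remainder_chebyshev_T_Suc_Suc[OF assms(1)] by simp
qed

lemma poly_remainder_chebyshev_T_even:
  assumes "\<alpha> > -1" "n \<ge> 1"
  shows "poly_remainder \<alpha> n (chebyshev_T (2 * n + 2 * l + 2))
     = jacobi_norm \<alpha> n * (gegenbauer_mu \<alpha> n (l + 1) - gegenbauer_mu \<alpha> n l) / 2"
  using gegenbauer_mu_eq_remainder[OF assms, of "l + 1"] gegenbauer_mu_eq_remainder[OF assms, of l]
    poly_remainder_chebyshev_T_Suc_Suc[OF assms(1), of n "2 * n + 2 * l"]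
  by (simp add: right_diff_distrib del: chebyshev_T.simps chebyshev_U.simps)

text \<open>Continuity of the remainder in the sup norm. It controls the truncation error of the
  expansion and bounds the remainders of all T_k uniformly.\<close>

lemma gauss_remainder_bound:
  assumes "\<alpha> > -1" "continuous_on {-1..1} (\<lambda>x. u (complex_of_real x))"
    and bd: "\<And>x. x \<in> {-1<..<1} \<Longrightarrow> cmod (u (of_real x)) \<le> \<epsilon>"
  shows "cmod (gauss_remainder \<alpha> n u) \<le> \<epsilon> * ((LBINT x:{-1<..<1}. gegenbauer_weight \<alpha> x)
     + (\<Sum>x\<in>gauss_nodes \<alpha> n. \<bar>gauss_weight \<alpha> n x\<bar>))"
proof -
  let ?f = "\<lambda>x. u (of_real x) * of_real (gegenbauer_weight \<alpha> x)"
  have w0: "0 \<le> gegenbauer_weight \<alpha> x" for x by (simp add: gegenbauer_weight_def)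
  have int: "set_integrable lborel {-1<..<1} ?f"
    using set_integrable_weight_scaleR[OF assms(1,2)] by (simp add: scaleR_conv_of_real mult.commute)
  have intw: "set_integrable lborel {-1<..<1} (\<lambda>x. \<epsilon> * gegenbauer_weight \<alpha> x)"
    using set_integrable_gegenbauer_weight[OF assms(1)] by (intro set_integrable_mult_right) auto
  have "cmod (LBINT x:{-1<..<1}. ?f x) \<le> (LBINT x:{-1<..<1}. cmod (?f x))"
    by (rule set_integral_norm_bound[OF int])
  also have "\<dots> \<le> (LBINT x:{-1<..<1}. \<epsilon> * gegenbauer_weight \<alpha> x)"
    by (intro set_integral_mono set_integrable_norm int intw)
       (auto simp: norm_mult w0 intro!: mult_right_mono bd)
  also have "\<dots> = \<epsilon> * (LBINT x:{-1<..<1}. gegenbauer_weight \<alpha> x)" by simp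
  finally have 1: "cmod (LBINT x:{-1<..<1}. ?f x) \<le> \<epsilon> * (LBINT x:{-1<..<1}. gegenbauer_weight \<alpha> x)" .
  have "cmod (\<Sum>x\<in>gauss_nodes \<alpha> n. u (of_real x) * of_real (gauss_weight \<alpha> n x))
     \<le> (\<Sum>x\<in>gauss_nodes \<alpha> n. \<epsilon> * \<bar>gauss_weight \<alpha> n x\<bar>)"
    using gauss_nodes_subset[OF assms(1), of n]
    by (intro sum_norm_le) (auto simp: norm_mult intro!: mult_right_mono bd)
  then show ?thesis using 1 unfolding gauss_remainder_def
    by (intro order_trans[OF norm_triangle_ineq4]) (simp add: distrib_left sum_distrib_left)
qed

text \<open>Composition with \<open>Re\<close> turns a real polynomial into a function on the
  complex plane; the remainder evaluates it at real points only.\<close>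

lemma gauss_remainder_poly:
  "gauss_remainder \<alpha> n (\<lambda>z. of_real (poly p (Re z))) = of_real (poly_remainder \<alpha> n p)"
proof -
  have "(LBINT x:{-1<..<1}. complex_of_real (poly p x) * of_real (gegenbauer_weight \<alpha> x))
     = of_real (LBINT x:{-1<..<1}. poly p x * gegenbauer_weight \<alpha> x)"
    unfolding of_real_mult[symmetric] by (rule set_integral_complex_of_real)
  then show ?thesis by (simp add: gauss_remainder_def poly_remainder_def)
qed

lemma gauss_remainder_diff:
  assumes "\<alpha> > -1" "continuous_on {-1..1} (\<lambda>x. u (complex_of_real x))" "continuous_on {-1..1} (\<lambda>x. v (complex_of_real x))"
  shows "gauss_remainder \<alpha> n (\<lambda>z. u z - v z) = gauss_remainder \<alpha> n u - gauss_remainder \<alpha> n v"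
proof -
  have int: "set_integrable lborel {-1<..<1} (\<lambda>x. u (of_real x) * of_real (gegenbauer_weight \<alpha> x))"
     "set_integrable lborel {-1<..<1} (\<lambda>x. v (of_real x) * of_real (gegenbauer_weight \<alpha> x))"
    using set_integrable_weight_scaleR[OF assms(1,2)] set_integrable_weight_scaleR[OF assms(1,3)]
    by (simp_all add: scaleR_conv_of_real mult.commute)
  show ?thesis
    unfolding gauss_remainder_def left_diff_distrib set_integral_diff(2)[OF int] sum_subtractf by simp
qed

lemma gauss_remainder_chebyshev_sum:
  assumes "\<alpha> > -1"
  shows "gauss_remainder \<alpha> n (\<lambda>z. \<Sum>k<N. a k * of_real (poly (chebyshev_T k) (Re z)))
     = (\<Sum>k<N. a k * of_real (poly_remainder \<alpha> n (chebyshev_T k)))"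
proof -
  have int: "set_integrable lborel {-1<..<1} (\<lambda>x. a k * complex_of_real (poly (chebyshev_T k) x) * of_real (gegenbauer_weight \<alpha> x))" for k
    using set_integrable_weight_scaleR[OF assms, of "\<lambda>x. a k * complex_of_real (poly (chebyshev_T k) x)"]
    by (simp add: scaleR_conv_of_real mult.commute continuous_intros)
  have 1: "(LBINT x:{-1<..<1}. (\<Sum>k<N. a k * complex_of_real (poly (chebyshev_T k) x)) * of_real (gegenbauer_weight \<alpha> x))
    = (\<Sum>k<N. LBINT x:{-1<..<1}. a k * complex_of_real (poly (chebyshev_T k) x) * of_real (gegenbauer_weight \<alpha> x))"
    using int unfolding sum_distrib_right set_lebesgue_integral_def set_integrable_def scaleR_sum_right
    by (intro Bochner_Integration.integral_sum) auto
  have 2: "(LBINT x:{-1<..<1}. a k * complex_of_real (poly (chebyshev_T k) x) * of_real (gegenbauer_weight \<alpha> x))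
     = a k * of_real (LBINT x:{-1<..<1}. poly (chebyshev_T k) x * gegenbauer_weight \<alpha> x)" for k
    unfolding mult.assoc of_real_mult[symmetric] by (simp only: set_integral_mult_right set_integral_complex_of_real)
  have 3: "(\<Sum>x\<in>gauss_nodes \<alpha> n. (\<Sum>k<N. a k * complex_of_real (poly (chebyshev_T k) x)) * of_real (gauss_weight \<alpha> n x))
     = (\<Sum>k<N. a k * of_real (\<Sum>x\<in>gauss_nodes \<alpha> n. poly (chebyshev_T k) x * gauss_weight \<alpha> n x))"
    unfolding sum_distrib_right of_real_sum sum_distrib_left of_real_mult
    by (subst sum.swap) (simp add: mult.assoc)
  show ?thesis
    by (simp add: gauss_remainder_def poly_remainder_def 1 2 3 right_diff_distrib sum_subtractf)
qed

lemma abs_chebyshev_T_le_1: "x \<in> {-1<..<1} \<Longrightarrow> \<bar>poly (chebyshev_T k) x\<bar> \<le> 1"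
  by (erule interval_cosE) (simp add: chebyshev_T_cos)

lemma poly_remainder_chebyshev_T_bound:
  assumes "\<alpha> > -1"
  shows "\<bar>poly_remainder \<alpha> n (chebyshev_T k)\<bar> \<le> (LBINT x:{-1<..<1}. gegenbauer_weight \<alpha> x)
     + (\<Sum>x\<in>gauss_nodes \<alpha> n. \<bar>gauss_weight \<alpha> n x\<bar>)"
  using gauss_remainder_bound[OF assms, of "\<lambda>z. of_real (poly (chebyshev_T k) (Re z))" 1 n]
  by (simp add: gauss_remainder_poly abs_chebyshev_T_le_1 continuous_intros)

text \<open>Without boundedness the real \<open>SUP\<close> of the theorem would carry no meaning.
  It follows from |T_k| <= 1 on the interval, which makes the remainders bounded independently of
  k.\<close>

lemma bdd_above_gegenbauer_mu_diff:
  assumes "\<alpha> > -1" "n \<ge> 1"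
  shows "bdd_above (range (\<lambda>l. \<bar>gegenbauer_mu \<alpha> n (l + 1) - gegenbauer_mu \<alpha> n l\<bar>))"
proof -
  let ?B = "(LBINT x:{-1<..<1}. gegenbauer_weight \<alpha> x) + (\<Sum>x\<in>gauss_nodes \<alpha> n. \<bar>gauss_weight \<alpha> n x\<bar>)"
  note \<gamma> = jacobi_norm_pos[OF assms(1), of n]
  have "\<bar>gegenbauer_mu \<alpha> n (l + 1) - gegenbauer_mu \<alpha> n l\<bar> \<le> 2 * ?B / jacobi_norm \<alpha> n" for l
  proof -
    have "\<bar>jacobi_norm \<alpha> n * (gegenbauer_mu \<alpha> n (l + 1) - gegenbauer_mu \<alpha> n l) / 2\<bar> \<le> ?B"
      using poly_remainder_chebyshev_T_bound[OF assms(1), of n "2 * n + 2 * l + 2"]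
      unfolding poly_remainder_chebyshev_T_even[OF assms] .
    then have "jacobi_norm \<alpha> n * \<bar>gegenbauer_mu \<alpha> n (l + 1) - gegenbauer_mu \<alpha> n l\<bar> / 2 \<le> ?B"
      using \<gamma> by (simp only: abs_mult abs_divide abs_of_pos abs_numeral)
    then show ?thesis using \<gamma> by (simp add: field_simps)
  qed
  then show ?thesis by (intro bdd_aboveI2) 
qed

section \<open>Chebyshev expansion on the Bernstein ellipse\<close>

definition joukowski :: "complex \<Rightarrow> complex" where
  "joukowski w = (w + inverse w) / 2"

text \<open>Focal description with foci -1 and 1 and major axis \<rho> + 1/\<rho>; convexity is then
  just the triangle inequality.\<close>

definition filled_ellipse :: "real \<Rightarrow> complex set" where
  "filled_ellipse \<rho> = {z. cmod (z - 1) + cmod (z + 1) \<le> \<rho> + 1 / \<rho>}"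

text \<open>Both distances come from perfect squares, (w - 1)^2 / (2w) and (w + 1)^2 / (2w); the
  parallelogram law adds them.\<close>

lemma joukowski_focal_sum:
  assumes "w \<noteq> 0"
  shows "cmod (joukowski w - 1) + cmod (joukowski w + 1) = cmod w + 1 / cmod w"
proof -
  have "joukowski w - 1 = (w - 1)\<^sup>2 / (2 * w)" "joukowski w + 1 = (w + 1)\<^sup>2 / (2 * w)"
    using assms by (simp_all add: joukowski_def field_simps power2_eq_square)
  then have "cmod (joukowski w - 1) + cmod (joukowski w + 1) = ((cmod (w - 1))\<^sup>2 + (cmod (w + 1))\<^sup>2) / (2 * cmod w)"
    by (simp add: norm_divide norm_mult norm_power add_divide_distrib)
  also have "(cmod (w - 1))\<^sup>2 + (cmod (w + 1))\<^sup>2 = 2 * (cmod w)\<^sup>2 + 2"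
    unfolding cmod_power2 by (simp add: power2_eq_square algebra_simps)
  finally show ?thesis using assms by (simp add: field_simps power2_eq_square)
qed

text \<open>The two preimages z + s and z - s, with s^2 = z^2 - 1, have product 1, so one of them
  has modulus at least 1.\<close>

lemma joukowski_surj:
  obtains w where "cmod w \<ge> 1" "z = joukowski w"
proof -
  define s where "s = csqrt (z\<^sup>2 - 1)"
  have "(z + s) * (z - s) = z\<^sup>2 - s\<^sup>2" by (simp add: algebra_simps power2_eq_square)
  also have "\<dots> = 1" by (simp add: s_def)
  finally have prod: "(z + s) * (z - s) = 1" .
  then have inv: "inverse (z + s) = z - s" "inverse (z - s) = z + s"
    by (metis inverse_unique, metis inverse_unique mult.commute)
  have "cmod (z + s) * cmod (z - s) = 1" using prod by (metis norm_mult norm_one)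
  then have "cmod (z + s) \<ge> 1 \<or> cmod (z - s) \<ge> 1"
    using mult_left_mono[of "cmod (z - s)" 1 "cmod (z + s)"] by fastforce
  then show ?thesis
    using that[of "z + s"] that[of "z - s"] inv by (auto simp: joukowski_def)
qed

lemma bernstein_ellipse_eq:
  assumes "\<rho> > 1"
  shows "bernstein_ellipse \<rho> = {z. cmod (z - 1) + cmod (z + 1) = \<rho> + 1 / \<rho>}"
proof (intro set_eqI iffI)
  fix z assume "z \<in> bernstein_ellipse \<rho>"
  then obtain \<theta> where z: "z = joukowski (of_real \<rho> * exp (\<i> * of_real \<theta>))"
    by (auto simp: bernstein_ellipse_def joukowski_def)
  show "z \<in> {z. cmod (z - 1) + cmod (z + 1) = \<rho> + 1 / \<rho>}"
    unfolding z using joukowski_focal_sum[of "of_real \<rho> * exp (\<i> * of_real \<theta>)"] assms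
    by (simp add: norm_mult)
next
  fix z assume z: "z \<in> {z. cmod (z - 1) + cmod (z + 1) = \<rho> + 1 / \<rho>}"
  obtain w where w: "cmod w \<ge> 1" "z = joukowski w" by (rule joukowski_surj)
  let ?r = "cmod w"
  have "?r + 1 / ?r = \<rho> + 1 / \<rho>" using joukowski_focal_sum[of w] w z by fastforce
  \<comment> \<open>Equal focal sums force the product to vanish; its second factor is positive, so
    r = \<rho>.\<close>
  moreover have "(r - \<rho>) * (r * \<rho> - 1) = \<rho> * r * ((r + 1 / r) - (\<rho> + 1 / \<rho>))" if "r \<ge> 1" for r
    using that assms by (simp add: field_simps)
  ultimately have "(?r - \<rho>) * (?r * \<rho> - 1) = 0" using w(1) by simp
  moreover have "1 * \<rho> \<le> ?r * \<rho>" using w(1) assms by (intro mult_right_mono) auto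
  then have "?r * \<rho> > 1" using assms by linarith
  ultimately have r: "?r = \<rho>" by simp
  have "w = of_real \<rho> * exp (\<i> * of_real (Arg2pi w))" using Arg2pi_eq[of w] r by simp
  moreover have "Arg2pi w \<in> {0..2 * pi}" using Arg2pi_ge_0[of w] Arg2pi_lt_2pi[of w] by auto
  ultimately show "z \<in> bernstein_ellipse \<rho>"
    unfolding bernstein_ellipse_def using w(2) joukowski_def by blast
qed

text \<open>The sets of smaller and of larger focal sum are open and disjoint, so a component of the
  complement of the ellipse that meets the first stays in it, and the first is bounded. This carries
  analyticity over to a convex set.\<close>

lemma filled_ellipse_subset:
  assumes "\<rho> > 1"
  shows "filled_ellipse \<rho> \<subseteq> bernstein_ellipse \<rho> \<union> inside (bernstein_ellipse \<rho>)"
proof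
  let ?E = "bernstein_ellipse \<rho>"
  let ?h = "\<lambda>z. cmod (z - 1) + cmod (z + 1)"
  let ?L = "{z. ?h z < \<rho> + 1 / \<rho>}" and ?O = "{z. \<rho> + 1 / \<rho> < ?h z}"
  fix z assume "z \<in> filled_ellipse \<rho>"
  then have z: "z \<in> ?E \<or> z \<in> ?L" by (auto simp: filled_ellipse_def bernstein_ellipse_eq[OF assms])
  have op: "open ?L" "open ?O" by (intro open_Collect_less continuous_intros)+
  have "bounded ?L"
  proof (rule bounded_subset[OF bounded_cball[of 1 "\<rho> + 1 / \<rho>"]])
    show "?L \<subseteq> cball 1 (\<rho> + 1 / \<rho>)"
    proof
      fix y assume "y \<in> ?L"
      then show "y \<in> cball 1 (\<rho> + 1 / \<rho>)" using norm_ge_zero[of "y + 1"] unfolding mem_Collect_eq mem_cball dist_norm norm_minus_commute[of 1 y] by linarith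
    qed
  qed
  moreover have "connected_component_set (- ?E) z \<subseteq> ?L" if "z \<in> ?L"
  proof -
    let ?C = "connected_component_set (- ?E) z"
    have "z \<in> - ?E" using that by (auto simp: bernstein_ellipse_eq[OF assms])
    then have "z \<in> ?C" by simp
    have "?C \<subseteq> - ?E" by (rule connected_component_subset)
    then have "?C \<subseteq> ?L \<union> ?O" by (auto simp: bernstein_ellipse_eq[OF assms])
    moreover have "?L \<inter> ?O \<inter> ?C = {}" by auto
    ultimately have "?L \<inter> ?C = {} \<or> ?O \<inter> ?C = {}"
      using connectedD[OF connected_connected_component op] by blast
    then have "?O \<inter> ?C = {}" using that \<open>z \<in> ?C\<close> by auto
    then show ?thesis using \<open>?C \<subseteq> ?L \<union> ?O\<close> by auto
  qed
  ultimately have "z \<in> inside ?E" if "z \<in> ?L"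
    using that bounded_subset by (auto simp: inside_def bernstein_ellipse_eq[OF assms])
  then show "z \<in> ?E \<union> inside ?E" using z by blast
qed

lemma convex_filled_ellipse: "convex (filled_ellipse \<rho>)"
  unfolding convex_alt
proof (intro ballI allI impI)
  fix x y :: complex and u :: real
  assume xy: "x \<in> filled_ellipse \<rho>" "y \<in> filled_ellipse \<rho>" and u: "0 \<le> u \<and> u \<le> 1"
  have tri: "cmod ((1 - u) *\<^sub>R x + u *\<^sub>R y - c) \<le> (1 - u) * cmod (x - c) + u * cmod (y - c)" for c
  proof -
    have "(1 - u) *\<^sub>R x + u *\<^sub>R y - c = (1 - u) *\<^sub>R (x - c) + u *\<^sub>R (y - c)"
      by (simp add: algebra_simps)
    then show ?thesis using norm_triangle_ineq[of "(1 - u) *\<^sub>R (x - c)" "u *\<^sub>R (y - c)"] u by simp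
  qed
  have "cmod ((1 - u) *\<^sub>R x + u *\<^sub>R y - 1) + cmod ((1 - u) *\<^sub>R x + u *\<^sub>R y + 1)
     \<le> (1 - u) * (cmod (x - 1) + cmod (x + 1)) + u * (cmod (y - 1) + cmod (y + 1))"
    using tri[of 1] tri[of "-1"] by (simp add: distrib_left)
  also have "\<dots> \<le> (1 - u) * (\<rho> + 1 / \<rho>) + u * (\<rho> + 1 / \<rho>)"
    using xy u by (intro add_mono[OF mult_left_mono mult_left_mono]) (auto simp: filled_ellipse_def)
  also have "\<dots> = \<rho> + 1 / \<rho>" by (simp add: left_diff_distrib)
  finally show "(1 - u) *\<^sub>R x + u *\<^sub>R y \<in> filled_ellipse \<rho>"
    by (simp add: filled_ellipse_def)
qed

lemma focal_segment_less:
  assumes "\<rho> > 1" "x \<in> {-1..1}"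
  shows "cmod (complex_of_real x - 1) + cmod (of_real x + 1) < \<rho> + 1 / \<rho>"
proof -
  have "cmod (of_real x - 1) = 1 - x" "cmod (of_real x + 1) = 1 + x"
    using assms(2) norm_of_real[of "x - 1", where ?'a=complex] norm_of_real[of "x + 1", where ?'a=complex] by auto
  moreover have "0 < (\<rho> - 1)\<^sup>2 / \<rho>" using assms(1) by simp
  then have "2 < \<rho> + 1 / \<rho>" using assms(1) by (simp add: power2_eq_square field_simps)
  ultimately show ?thesis by simp
qed

lemma focal_segment_interior:
  assumes "\<rho> > 1" "x \<in> {-1..1}"
  shows "complex_of_real x \<in> interior (filled_ellipse \<rho>)"
proof (rule interiorI)
  let ?L = "{z. cmod (z - 1) + cmod (z + 1) < \<rho> + 1 / \<rho>}"
  show "open ?L" by (intro open_Collect_less continuous_intros)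
  show "complex_of_real x \<in> ?L" using focal_segment_less[OF assms] by simp
  show "?L \<subseteq> filled_ellipse \<rho>" by (auto simp: filled_ellipse_def)
qed

text \<open>The Cauchy kernel pulled back to the circle, where w times the derivative of the
  Joukowski map is (w - 1/w) / 2. It equals 1/(1 - a) + 1/(1 - b) - 1 with a = e/w and b = 1/(e w),
  both of modulus 1/\<rho>, and each geometric tail contributes half of the error. The -1 makes the
  term k = 0 count once, which needs N >= 1.\<close>

lemma joukowski_kernel_expansion:
  fixes w e :: complex
  assumes w: "cmod w = \<rho>" and \<rho>: "\<rho> > 1" and e: "cmod e = 1" and N: "N \<ge> 1"
  shows "cmod ((w - inverse w) / 2 / (joukowski w - joukowski e) - (\<Sum>k<N. (if k = 0 then 1 else e ^ k + inverse e ^ k) * inverse w ^ k))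
    \<le> 2 / (1 - 1 / \<rho>) * (1 / \<rho>) ^ N"
proof -
  have nz: "w \<noteq> 0" "e \<noteq> 0" using assms by auto
  define a where "a = e * inverse w"
  define b where "b = inverse e * inverse w"
  have na: "cmod a = 1 / \<rho>" "cmod b = 1 / \<rho>"
    using assms by (simp_all add: a_def b_def norm_mult norm_inverse divide_inverse)
  then have "cmod a < 1" "cmod b < 1" using \<rho> by simp_all
  then have ab: "a \<noteq> 1" "b \<noteq> 1" by auto
  have we: "w \<noteq> e" "w * e \<noteq> 1" using ab nz by (auto simp: a_def b_def field_simps)
  have dif: "joukowski w - joukowski e = (w - e) * (w * e - 1) / (2 * w * e)"
    using nz by (simp add: joukowski_def field_simps)
  have "(w - inverse w) / 2 / (joukowski w - joukowski e) = (w * w - 1) * e / ((w - e) * (w * e - 1))"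
    unfolding dif using nz we by (simp add: divide_simps)
  also have "\<dots> = 1 / (1 - a) + 1 / (1 - b) - 1"
  proof -
    have 1: "1 - a = (w - e) / w" "1 - b = (w * e - 1) / (w * e)"
      using nz by (simp_all add: a_def b_def field_simps)
    show ?thesis unfolding 1 using nz we by (simp add: divide_simps) (simp add: algebra_simps)
  qed
  also have "1 / (1 - a) = (\<Sum>k<N. a ^ k) + a ^ N / (1 - a)"
    using ab by (simp add: sum_gp_strict add_divide_distrib[symmetric])
  also have "1 / (1 - b) = (\<Sum>k<N. b ^ k) + b ^ N / (1 - b)"
    using ab by (simp add: sum_gp_strict add_divide_distrib[symmetric])
  finally have main: "(w - inverse w) / 2 / (joukowski w - joukowski e)
     = ((\<Sum>k<N. a ^ k) + (\<Sum>k<N. b ^ k) - 1) + (a ^ N / (1 - a) + b ^ N / (1 - b))"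
    by (simp add: algebra_simps)
  have "(\<Sum>k<N. (if k = 0 then 1 else e ^ k + inverse e ^ k) * inverse w ^ k)
     = (\<Sum>k<N. a ^ k + b ^ k - (if k = 0 then 1 else 0))"
    by (rule sum.cong) (auto simp: a_def b_def power_mult_distrib algebra_simps)
  also have "\<dots> = (\<Sum>k<N. a ^ k) + (\<Sum>k<N. b ^ k) - 1"
    using N by (simp add: sum.distrib sum_subtractf)
  finally have S: "(\<Sum>k<N. (if k = 0 then 1 else e ^ k + inverse e ^ k) * inverse w ^ k) = (\<Sum>k<N. a ^ k) + (\<Sum>k<N. b ^ k) - 1" .
  have geo: "cmod (c ^ N / (1 - c)) \<le> 1 / (1 - 1 / \<rho>) * (1 / \<rho>) ^ N" if "cmod c = 1 / \<rho>" for c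
  proof -
    have "1 - 1 / \<rho> \<le> cmod (1 - c)" using norm_triangle_ineq2[of 1 c] that by simp
    moreover have "0 < 1 - 1 / \<rho>" using \<rho> by simp
    ultimately have "cmod (c ^ N / (1 - c)) \<le> (1 / \<rho>) ^ N / (1 - 1 / \<rho>)"
      unfolding norm_divide norm_power that using \<rho> by (intro divide_left_mono mult_pos_pos) auto
    then show ?thesis by simp
  qed
  have "cmod (a ^ N / (1 - a) + b ^ N / (1 - b)) \<le> 1 / (1 - 1 / \<rho>) * (1 / \<rho>) ^ N + 1 / (1 - 1 / \<rho>) * (1 / \<rho>) ^ N"
    by (intro norm_triangle_mono geo na)
  then show ?thesis unfolding main S by simp
qed

section \<open>The circle and its Joukowski image as parametrized curves\<close>

definition circle_point :: "real \<Rightarrow> real \<Rightarrow> complex" where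
  "circle_point \<rho> t = of_real \<rho> * exp (2 * of_real pi * \<i> * of_real t)"

lemma circle_point_eq_circlepath: "circle_point \<rho> = circlepath 0 \<rho>"
  by (simp add: circle_point_def circlepath fun_eq_iff)

lemma norm_circle_point [simp]: "cmod (circle_point \<rho> t) = \<bar>\<rho>\<bar>"
proof -
  have "2 * of_real pi * \<i> * of_real t = \<i> * of_real (2 * pi * t)" by simp
  then show ?thesis by (simp only: circle_point_def norm_mult norm_exp_i_times) simp
qed

lemma circle_point_nonzero: "\<rho> > 0 \<Longrightarrow> circle_point \<rho> t \<noteq> 0"
  by (simp add: circle_point_def)

lemma circle_point_1: "circle_point \<rho> 1 = circle_point \<rho> 0"
  using pathfinish_circlepath[of 0 \<rho>] pathstart_circlepath[of 0 \<rho>]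
  by (simp add: circle_point_eq_circlepath pathfinish_def pathstart_def)

lemma joukowski_circle_point:
  assumes "t \<in> {0..1}"
  shows "joukowski (circle_point \<rho> t) \<in> bernstein_ellipse \<rho>"
  unfolding bernstein_ellipse_def joukowski_def circle_point_def using assms
  by (intro CollectI exI[of _ "of_real \<rho> * exp (2 * of_real pi * \<i> * of_real t)"] conjI bexI[of _ "2 * pi * t"])
     (auto simp: mult_ac)

lemma circle_point_has_vector_derivative:
  "(circle_point \<rho> has_vector_derivative 2 * of_real pi * \<i> * circle_point \<rho> t) (at t)"
  unfolding circle_point_eq_circlepath
  by (rule has_vector_derivative_eq_rhs[OF has_vector_derivative_circlepath]) (simp add: circlepath)

lemma joukowski_circle_point_has_vector_derivative:
  assumes "\<rho> > 0"
  shows "((\<lambda>t. joukowski (circle_point \<rho> t)) has_vector_derivative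
      2 * of_real pi * \<i> * ((circle_point \<rho> t - inverse (circle_point \<rho> t)) / 2)) (at t)"
proof -
  let ?w = "circle_point \<rho> t"
  have nz: "?w \<noteq> 0" using assms by (rule circle_point_nonzero)
  have "(joukowski has_field_derivative (1 - inverse (?w\<^sup>2)) / 2) (at ?w)"
    unfolding joukowski_def[abs_def] using nz
    by (auto intro!: derivative_eq_intros simp: power2_eq_square)
  from field_vector_diff_chain_at[OF circle_point_has_vector_derivative this]
  show ?thesis
    unfolding o_def by (rule has_vector_derivative_eq_rhs) (use nz in \<open>simp add: field_simps power2_eq_square\<close>)
qed

lemma continuous_on_circle_point: "continuous_on A (circle_point \<rho>)"
  unfolding circle_point_def by (intro continuous_intros)

text \<open>For k > 0 the antiderivative takes equal values at 0 and 1. These are the expansion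
  coefficients of the constant function 1.\<close>

lemma circle_point_power_integral:
  assumes "\<rho> > 0"
  shows "((\<lambda>t. inverse (circle_point \<rho> t) ^ k) has_integral (if k = 0 then 1 else 0)) {0..1}"
proof (cases "k = 0")
  case True
  then show ?thesis using has_integral_const_real[of "1::complex" 0 1] by simp
next
  case False
  let ?c = "- (2 * of_real pi * \<i> * of_nat k)"
  let ?F = "\<lambda>t. inverse (circle_point \<rho> t) ^ k / ?c"
  have nz: "circle_point \<rho> t \<noteq> 0" for t using assms by (rule circle_point_nonzero)
  have "((\<lambda>t. inverse (circle_point \<rho> t) ^ k) has_integral (?F 1 - ?F 0)) {0..1}"
  proof (rule fundamental_theorem_of_calculus)
    fix t :: real
    let ?w = "circle_point \<rho> t"
    have "((\<lambda>w. inverse w ^ k / ?c) has_field_derivative (of_nat k * (- inverse (?w\<^sup>2)) * inverse ?w ^ (k - 1)) / ?c) (at ?w)"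
      using nz[of t] by (auto intro!: derivative_eq_intros simp: power2_eq_square)
    from field_vector_diff_chain_at[OF circle_point_has_vector_derivative this]
    have "(?F has_vector_derivative inverse ?w ^ k) (at t)"
      unfolding o_def
    proof (rule has_vector_derivative_eq_rhs)
      obtain j where "k = Suc j" using False by (cases k) auto
      then show "2 * of_real pi * \<i> * ?w * (of_nat k * (- inverse (?w\<^sup>2)) * inverse ?w ^ (k - 1) / ?c) = inverse ?w ^ k"
        using nz[of t] False by (simp add: divide_simps power2_eq_square del: of_nat_Suc)
    qed
    then show "(?F has_vector_derivative inverse ?w ^ k) (at t within {0..1})"
      by (rule has_vector_derivative_at_within)
  qed auto
  then show ?thesis using False by (simp add: circle_point_1)
qed

text \<open>Cauchy's formula along the ellipse, with the pulled-back kernel truncated under the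
  integral. Writing the point as the Joukowski image of e^(i \<theta>) turns the powers of e into 2
  cos(k \<theta>), whence the factor 2 in \<open>a\<close>. The winding number remains an unknown
  factor here.\<close>

lemma Cauchy_ellipse_approx:
  fixes u :: "complex \<Rightarrow> complex"
  assumes \<rho>: "\<rho> > 1"
    and cont: "continuous_on (filled_ellipse \<rho>) u"
    and diff: "\<And>z. z \<in> interior (filled_ellipse \<rho>) \<Longrightarrow> u field_differentiable at z"
    and M: "\<And>z. z \<in> bernstein_ellipse \<rho> \<Longrightarrow> cmod (u z) \<le> M"
    and N: "N \<ge> 1"
  defines "a \<equiv> \<lambda>k. (if k = 0 then 1 else 2) * integral {0..1} (\<lambda>t. u (joukowski (circle_point \<rho> t)) * inverse (circle_point \<rho> t) ^ k)"
  shows "cmod (winding_number (\<lambda>t. joukowski (circle_point \<rho> t)) (of_real (cos \<theta>)) * u (of_real (cos \<theta>)) - (\<Sum>k<N. a k * of_real (cos (real k * \<theta>))))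
     \<le> M * (2 / (1 - 1 / \<rho>) * (1 / \<rho>) ^ N)"
    and "cmod (a k) \<le> 2 * M * (1 / \<rho>) ^ k"
proof -
  let ?W = "circle_point \<rho>"
  let ?\<gamma> = "\<lambda>t. joukowski (?W t)"
  have nz: "?W t \<noteq> 0" for t using \<rho> by (intro circle_point_nonzero) simp
  have E_sub: "bernstein_ellipse \<rho> \<subseteq> filled_ellipse \<rho>"
    by (auto simp: bernstein_ellipse_eq[OF \<rho>] filled_ellipse_def)
  have cont\<gamma>: "continuous_on {0..1} ?\<gamma>"
    unfolding joukowski_def using nz by (intro continuous_intros continuous_on_circle_point) auto
  have contu: "continuous_on {0..1} (\<lambda>t. u (?\<gamma> t))"
    using joukowski_circle_point E_sub by (intro continuous_on_compose2[OF cont cont\<gamma>]) auto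
  have int: "(\<lambda>t. u (?\<gamma> t) * inverse (?W t) ^ k) integrable_on {0..1}" for k
    using nz by (intro integrable_continuous_real continuous_intros contu continuous_on_circle_point) auto
  have M0: "0 \<le> M" by (rule order_trans[OF norm_ge_zero M[OF joukowski_circle_point[of 0]]]) simp
  have Wn: "cmod (inverse (?W t) ^ k) = (1 / \<rho>) ^ k" for t k
    using \<rho> by (simp add: norm_power norm_inverse divide_inverse)
  show "cmod (a k) \<le> 2 * M * (1 / \<rho>) ^ k"
  proof -
    have "cmod (integral {0..1} (\<lambda>t. u (?\<gamma> t) * inverse (?W t) ^ k)) \<le> (M * (1 / \<rho>) ^ k) * (1 - 0)"
    proof (rule integral_bound)
      show "continuous_on {0..1} (\<lambda>t. u (?\<gamma> t) * inverse (?W t) ^ k)"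
        using nz by (intro continuous_intros contu continuous_on_circle_point) auto
      show "cmod (u (?\<gamma> t) * inverse (?W t) ^ k) \<le> M * (1 / \<rho>) ^ k" if "t \<in> {0..1}" for t
        unfolding norm_mult Wn using that \<rho> by (intro mult_right_mono M joukowski_circle_point) auto
    qed simp
    then have "(if k = 0 then 1 else 2) * cmod (integral {0..1} (\<lambda>t. u (?\<gamma> t) * inverse (?W t) ^ k)) \<le> 2 * (M * (1 / \<rho>) ^ k)"
      using M0 \<rho> by (intro mult_mono) auto
    then show ?thesis by (simp add: a_def norm_mult if_distrib[of cmod] split: if_splits)
  qed
  let ?x = "of_real (cos \<theta>) :: complex"
  let ?e = "exp (\<i> * of_real \<theta>)"
  have e: "cmod ?e = 1" by simp
  have inv_e: "inverse ?e = exp (- (\<i> * of_real \<theta>))" by (simp add: exp_minus)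
  have x: "?x = joukowski ?e"
    unfolding joukowski_def inv_e cos_of_real[symmetric] cos_exp_eq by simp
  have cosk: "?e ^ k + inverse ?e ^ k = 2 * of_real (cos (real k * \<theta>))" for k
    unfolding inv_e exp_of_nat_mult[symmetric] cos_of_real[symmetric] cos_exp_eq by (simp add: mult_ac)
  have xi: "?x \<in> interior (filled_ellipse \<rho>)" by (rule focal_segment_interior[OF \<rho>]) auto
  have not_E: "?x \<notin> bernstein_ellipse \<rho>"
    using focal_segment_less[OF \<rho>, of "cos \<theta>"] by (auto simp: bernstein_ellipse_eq[OF \<rho>])
  have "valid_path (joukowski \<circ> circlepath 0 \<rho>)"
  proof (rule valid_path_compose_holomorphic[of _ _ "- {0}"])
    show "joukowski holomorphic_on - {0}" unfolding joukowski_def by (intro holomorphic_intros) auto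
  qed (use \<rho> in auto)
  then have valid: "valid_path ?\<gamma>" by (simp add: o_def circle_point_eq_circlepath)
  have img: "path_image ?\<gamma> \<subseteq> filled_ellipse \<rho> - {?x}"
    using joukowski_circle_point E_sub not_E by (fastforce simp: path_image_def)
  have loop: "pathfinish ?\<gamma> = pathstart ?\<gamma>"
    by (simp add: pathfinish_def pathstart_def circle_point_1)
  have vd: "vector_derivative ?\<gamma> (at t) = 2 * of_real pi * \<i> * ((?W t - inverse (?W t)) / 2)" for t
    using \<rho> by (intro vector_derivative_at joukowski_circle_point_has_vector_derivative) simp
  define \<nu> where "\<nu> = winding_number ?\<gamma> ?x"
  have "((\<lambda>w. u w / (w - ?x)) has_contour_integral (2 * pi * \<i> * \<nu> * u ?x)) ?\<gamma>"
    unfolding \<nu>_def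
    by (rule Cauchy_integral_formula_convex[OF convex_filled_ellipse _ cont _ xi valid img loop, of "{}"])
       (use diff in auto)
  then have "((\<lambda>t. u (?\<gamma> t) / (?\<gamma> t - ?x) * (2 * of_real pi * \<i> * ((?W t - inverse (?W t)) / 2)))
      has_integral (2 * pi * \<i> * \<nu> * u ?x)) {0..1}"
    unfolding has_contour_integral vd .
  from has_integral_divide[OF this, of "2 * of_real pi * \<i>"]
  have "((\<lambda>t. u (?\<gamma> t) / (?\<gamma> t - ?x) * (2 * of_real pi * \<i> * ((?W t - inverse (?W t)) / 2)) / (2 * of_real pi * \<i>))
      has_integral (\<nu> * u ?x)) {0..1}" by simp
  moreover have "u (?\<gamma> t) / (?\<gamma> t - ?x) * (2 * of_real pi * \<i> * ((?W t - inverse (?W t)) / 2)) / (2 * of_real pi * \<i>)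
      = u (?\<gamma> t) * ((?W t - inverse (?W t)) / 2 / (?\<gamma> t - ?x))" for t
    by (simp add: mult.commute)
  ultimately have D: "((\<lambda>t. u (?\<gamma> t) * ((?W t - inverse (?W t)) / 2 / (?\<gamma> t - ?x))) has_integral (\<nu> * u ?x)) {0..1}"
    by (simp only:)
  let ?c = "\<lambda>k. (if k = 0 then 1 else 2) * complex_of_real (cos (real k * \<theta>))"
  have S: "((\<lambda>t. \<Sum>k<N. ?c k * (u (?\<gamma> t) * inverse (?W t) ^ k)) has_integral
      (\<Sum>k<N. ?c k * integral {0..1} (\<lambda>t. u (?\<gamma> t) * inverse (?W t) ^ k))) {0..1}"
    using int by (intro has_integral_sum has_integral_mult_right integrable_integral) auto
  have Sa: "(\<Sum>k<N. ?c k * integral {0..1} (\<lambda>t. u (?\<gamma> t) * inverse (?W t) ^ k)) = (\<Sum>k<N. a k * of_real (cos (real k * \<theta>)))"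
    by (simp add: a_def mult_ac)
  let ?B = "M * (2 / (1 - 1 / \<rho>) * (1 / \<rho>) ^ N)"
  \<comment> \<open>Both sides are integrals over an interval of length 1, so the pointwise bound, M
    times the kernel error, carries over.\<close>
  have "cmod (\<nu> * u ?x - (\<Sum>k<N. a k * of_real (cos (real k * \<theta>)))) \<le> ?B * measure lborel {0..1::real}"
  proof (rule has_integral_bound_real[where S = "{}"])
    show "((\<lambda>t. u (?\<gamma> t) * ((?W t - inverse (?W t)) / 2 / (?\<gamma> t - ?x)) - (\<Sum>k<N. ?c k * (u (?\<gamma> t) * inverse (?W t) ^ k)))
      has_integral (\<nu> * u ?x - (\<Sum>k<N. a k * of_real (cos (real k * \<theta>))))) {0..1}"
      using has_integral_diff[OF D S] unfolding Sa .
    fix t :: real assume "t \<in> {0..1} - {}"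
    then have t: "t \<in> {0..1}" by simp
    have "(\<Sum>k<N. ?c k * (u (?\<gamma> t) * inverse (?W t) ^ k)) = u (?\<gamma> t) * (\<Sum>k<N. (if k = 0 then 1 else ?e ^ k + inverse ?e ^ k) * inverse (?W t) ^ k)"
      unfolding sum_distrib_left cosk by (rule sum.cong) (auto simp: mult_ac)
    then have "cmod (u (?\<gamma> t) * ((?W t - inverse (?W t)) / 2 / (?\<gamma> t - ?x)) - (\<Sum>k<N. ?c k * (u (?\<gamma> t) * inverse (?W t) ^ k)))
      = cmod (u (?\<gamma> t)) * cmod ((?W t - inverse (?W t)) / 2 / (?\<gamma> t - joukowski ?e) - (\<Sum>k<N. (if k = 0 then 1 else ?e ^ k + inverse ?e ^ k) * inverse (?W t) ^ k))"
      unfolding x by (simp only: right_diff_distrib[symmetric] norm_mult)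
    also have "\<dots> \<le> ?B"
      using \<rho> by (intro mult_mono M joukowski_circle_point t joukowski_kernel_expansion e N) (auto intro: M0)
    finally show "cmod (u (?\<gamma> t) * ((?W t - inverse (?W t)) / 2 / (?\<gamma> t - ?x)) - (\<Sum>k<N. ?c k * (u (?\<gamma> t) * inverse (?W t) ^ k))) \<le> ?B" .
  qed (use M0 \<rho> in auto)
  then show "cmod (winding_number ?\<gamma> ?x * u ?x - (\<Sum>k<N. a k * of_real (cos (real k * \<theta>)))) \<le> ?B"
    by (simp add: \<nu>_def)
qed

text \<open>The approximation itself, applied to the constant function 1, determines the winding number.\<close>
lemma winding_number_ellipse:
  assumes "\<rho> > 1"
  shows "winding_number (\<lambda>t. joukowski (circle_point \<rho> t)) (of_real (cos \<theta>)) = 1"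
proof -
  let ?\<nu> = "winding_number (\<lambda>t. joukowski (circle_point \<rho> t)) (of_real (cos \<theta>))"
  have "cmod (?\<nu> - 1) \<le> 2 / (1 - 1 / \<rho>) * (1 / \<rho>) ^ Suc m" for m
  proof -
    have "(\<Sum>k<Suc m. (if k = 0 then 1 else 2) * integral {0..1} (\<lambda>t. inverse (circle_point \<rho> t) ^ k) * complex_of_real (cos (real k * \<theta>))) = 1"
      using assms by (simp add: sum.lessThan_Suc_shift integral_unique[OF circle_point_power_integral] del: sum.lessThan_Suc power_Suc)
    then show ?thesis
      using Cauchy_ellipse_approx(1)[of \<rho> "\<lambda>_. 1" 1 "Suc m" \<theta>] assms by simp
  qed
  moreover have "(\<lambda>m. 2 / (1 - 1 / \<rho>) * (1 / \<rho>) ^ Suc m) \<longlonglongrightarrow> 2 / (1 - 1 / \<rho>) * 0"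
    using assms by (intro tendsto_mult tendsto_const LIMSEQ_Suc LIMSEQ_power_zero) auto
  ultimately have "cmod (?\<nu> - 1) \<le> 2 / (1 - 1 / \<rho>) * 0"
    by (intro LIMSEQ_le_const) auto
  then show ?thesis by simp
qed

section \<open>Consequences for functions in \<open>analytic_ellipse\<close>\<close>

lemma chebyshev_expansion:
  assumes "\<rho> > 1" "u \<in> analytic_ellipse \<rho>" "\<forall>z\<in>bernstein_ellipse \<rho>. cmod (u z) \<le> M"
  obtains a where "\<And>k. cmod (a k) \<le> 2 * M * (1 / \<rho>) ^ k"
    "\<And>N \<theta>. N \<ge> 1 \<Longrightarrow> cmod (u (of_real (cos \<theta>)) - (\<Sum>k<N. a k * of_real (cos (real k * \<theta>)))) \<le> M * (2 / (1 - 1 / \<rho>) * (1 / \<rho>) ^ N)"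
proof -
  have an: "u analytic_on filled_ellipse \<rho>"
    using assms(2) filled_ellipse_subset[OF assms(1)] by (auto simp: analytic_ellipse_def intro: analytic_on_subset)
  then have cont: "continuous_on (filled_ellipse \<rho>) u"
    using analytic_imp_holomorphic holomorphic_on_imp_continuous_on by blast
  have diff: "u field_differentiable at z" if "z \<in> interior (filled_ellipse \<rho>)" for z
    using an that interior_subset analytic_on_imp_differentiable_at by blast
  note approx = Cauchy_ellipse_approx[OF assms(1) cont diff bspec[OF assms(3)], unfolded winding_number_ellipse[OF assms(1)] mult_1]
  show ?thesis by (rule that[OF approx(2)[OF _ _ order_refl] approx(1)])
qed

lemma continuous_on_focal_segment:
  assumes "\<rho> > 1" "u \<in> analytic_ellipse \<rho>"
  shows "continuous_on {-1..1} (\<lambda>x. u (complex_of_real x))"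
proof -
  have "u analytic_on filled_ellipse \<rho>"
    using assms(2) filled_ellipse_subset[OF assms(1)] by (auto simp: analytic_ellipse_def intro: analytic_on_subset)
  then have "continuous_on (filled_ellipse \<rho>) u"
    using analytic_imp_holomorphic holomorphic_on_imp_continuous_on by blast
  then show ?thesis
  proof (rule continuous_on_compose2)
    show "complex_of_real ` {-1..1} \<subseteq> filled_ellipse \<rho>"
      using focal_segment_interior[OF assms(1)] interior_subset[of "filled_ellipse \<rho>"] by blast
  qed (intro continuous_intros)
qed

section \<open>The remainder estimate\<close>

text \<open>Source of the factor 1 / (\<rho>^2 - 1): the terms of degree above 2n decay in steps of
  \<rho>^-2.\<close>

lemma sum_geometric_even_le:
  fixes r :: real
  assumes "r > 1"
  shows "(\<Sum>l<L. (1 / r) ^ (2 * l + 2)) \<le> 1 / (r\<^sup>2 - 1)"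
proof -
  let ?q = "(1 / r)\<^sup>2"
  have q: "0 < ?q" "?q < 1" using assms by (simp_all add: power_divide)
  have "(1 / r) ^ (2 * l + 2) = ?q * ?q ^ l" for l
    unfolding power_add power_mult by (rule mult.commute)
  then have "(\<Sum>l<L. (1 / r) ^ (2 * l + 2)) = ?q * (\<Sum>l<L. ?q ^ l)"
    by (simp only: sum_distrib_left)
  also have "\<dots> \<le> ?q * (1 / (1 - ?q))"
    using q by (intro mult_left_mono) (auto simp: sum_gp_strict intro!: divide_right_mono)
  also have "\<dots> = 1 / (r\<^sup>2 - 1)"
    using assms by (simp add: power_divide field_simps)
  finally show ?thesis .
qed

theorem theorem3p1:
  fixes \<rho> \<alpha> M :: real and n :: nat and u :: "complex \<Rightarrow> complex"
  assumes "\<rho> > 1"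
    and "u \<in> analytic_ellipse \<rho>"
    and "M \<in> (\<lambda>z. cmod (u z)) ` bernstein_ellipse \<rho>"
    and "\<forall>z\<in>bernstein_ellipse \<rho>. cmod (u z) \<le> M"
    and "\<alpha> > -1"
    and "n \<ge> 1"
  shows "bdd_above (range (\<lambda>l. \<bar>gegenbauer_mu \<alpha> n (l + 1) - gegenbauer_mu \<alpha> n l\<bar>)) \<and>
    cmod (gauss_remainder \<alpha> n u) \<le>
      jacobi_norm \<alpha> n *
        (\<bar>gegenbauer_mu \<alpha> n 0\<bar>
          + (SUP l. \<bar>gegenbauer_mu \<alpha> n (l + 1) - gegenbauer_mu \<alpha> n l\<bar>) * (1 / (\<rho>\<^sup>2 - 1)))
        * (M / \<rho> ^ (2 * n))"
proof
  show bdd: "bdd_above (range (\<lambda>l. \<bar>gegenbauer_mu \<alpha> n (l + 1) - gegenbauer_mu \<alpha> n l\<bar>))"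
    by (rule bdd_above_gegenbauer_mu_diff[OF assms(5,6)])
  let ?\<gamma> = "jacobi_norm \<alpha> n" and ?\<mu> = "gegenbauer_mu \<alpha> n"
  define S where "S = (SUP l. \<bar>?\<mu> (l + 1) - ?\<mu> l\<bar>)"
  define q where "q = 1 / \<rho>"
  define C where "C = (LBINT x:{-1<..<1}. gegenbauer_weight \<alpha> x) + (\<Sum>x\<in>gauss_nodes \<alpha> n. \<bar>gauss_weight \<alpha> n x\<bar>)"
  have S: "\<bar>?\<mu> (l + 1) - ?\<mu> l\<bar> \<le> S" for l unfolding S_def by (rule cSUP_upper[OF UNIV_I bdd])
  have S0: "0 \<le> S" using S[of 0] by linarith
  have M0: "0 \<le> M" using assms(3) by auto
  have \<gamma>: "0 < ?\<gamma>" by (rule jacobi_norm_pos[OF assms(5)])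
  have q: "0 < q" "q < 1" using assms(1) by (simp_all add: q_def)
  obtain a where a: "\<And>k. cmod (a k) \<le> 2 * M * q ^ k"
    and approx: "\<And>N \<theta>. N \<ge> 1 \<Longrightarrow> cmod (u (of_real (cos \<theta>)) - (\<Sum>k<N. a k * of_real (cos (real k * \<theta>)))) \<le> M * (2 / (1 - q) * q ^ N)"
    using chebyshev_expansion[OF assms(1,2,4)] unfolding q_def by blast
  let ?R = "\<lambda>k. poly_remainder \<alpha> n (chebyshev_T k)"
  let ?bound = "?\<gamma> * (\<bar>?\<mu> 0\<bar> + S * (1 / (\<rho>\<^sup>2 - 1))) * (M * q ^ (2 * n))"
  have main: "cmod (\<Sum>k<2 * n + 2 * L + 1. a k * of_real (?R k)) \<le> ?bound" for L
  proof -
    \<comment> \<open>The last degree kept is 2n + 2L. Raising L by one adds one odd degree, with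
      remainder 0, and one even degree.\<close>
    have split: "(\<Sum>k<2 * n + 2 * L + 1. a k * of_real (?R k))
      = a (2 * n) * of_real (?R (2 * n)) + (\<Sum>l<L. a (2 * n + 2 * l + 2) * of_real (?R (2 * n + 2 * l + 2)))"
    proof (induction L)
      case 0
      have "?R k = 0" if "k < 2 * n" for k
        by (rule poly_remainder_exact[OF assms(5)]) (use degree_chebyshev_T_le[of k] that in simp)
      then show ?case by simp
    next
      case (Suc L)
      have "2 * n + 2 * Suc L + 1 = Suc (Suc (2 * n + 2 * L + 1))" by simp
      moreover have "Suc (2 * n + 2 * L + 1) = 2 * n + 2 * L + 2" by simp
      ultimately show ?case using Suc poly_remainder_chebyshev_T_odd[OF assms(5,6), of L]
        by (simp only: sum.lessThan_Suc) simp
    qed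
    \<comment> \<open>The 2 of the coefficient bound meets the 1/2 in the remainder of
      T_{2n}.\<close>
    have 0: "cmod (a (2 * n) * of_real (?R (2 * n))) \<le> ?\<gamma> * \<bar>?\<mu> 0\<bar> * (M * q ^ (2 * n))"
    proof -
      have "cmod (a (2 * n) * of_real (?R (2 * n))) \<le> (2 * M * q ^ (2 * n)) * (?\<gamma> * \<bar>?\<mu> 0\<bar> / 2)"
        unfolding poly_remainder_chebyshev_T_0[OF assms(5,6)] norm_mult
        using \<gamma> by (intro mult_mono a) (auto simp: norm_mult norm_divide M0 q less_imp_le)
      then show ?thesis by (simp add: mult_ac)
    qed
    have "cmod (a (2 * n + 2 * l + 2) * of_real (?R (2 * n + 2 * l + 2))) \<le> ?\<gamma> * S * (M * q ^ (2 * n)) * q ^ (2 * l + 2)" for l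
    proof -
      have "cmod (of_real (?R (2 * n + 2 * l + 2))) = ?\<gamma> * \<bar>?\<mu> (l + 1) - ?\<mu> l\<bar> / 2"
        unfolding poly_remainder_chebyshev_T_even[OF assms(5,6)] norm_of_real abs_mult abs_divide
        using \<gamma> by simp
      also have "\<dots> \<le> ?\<gamma> * S / 2" using \<gamma> S[of l] by simp
      finally have "cmod (a (2 * n + 2 * l + 2) * of_real (?R (2 * n + 2 * l + 2))) \<le> (2 * M * q ^ (2 * n + 2 * l + 2)) * (?\<gamma> * S / 2)"
        unfolding norm_mult using M0 q by (intro mult_mono a) auto
      also have "\<dots> = ?\<gamma> * S * (M * q ^ (2 * n)) * q ^ (2 * l + 2)"
        by (simp add: power_add mult_ac)
      finally show ?thesis .
    qed
    then have "cmod (\<Sum>l<L. a (2 * n + 2 * l + 2) * of_real (?R (2 * n + 2 * l + 2))) \<le> (\<Sum>l<L. ?\<gamma> * S * (M * q ^ (2 * n)) * q ^ (2 * l + 2))"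
      by (intro sum_norm_le) auto
    also have "\<dots> = ?\<gamma> * S * (M * q ^ (2 * n)) * (\<Sum>l<L. q ^ (2 * l + 2))" by (simp only: sum_distrib_left)
    also have "\<dots> \<le> ?\<gamma> * S * (M * q ^ (2 * n)) * (1 / (\<rho>\<^sup>2 - 1))"
      using sum_geometric_even_le[OF assms(1)] S0 M0 q \<gamma> unfolding q_def[symmetric] by (intro mult_left_mono) auto
    finally have "cmod (\<Sum>k<2 * n + 2 * L + 1. a k * of_real (?R k))
        \<le> ?\<gamma> * \<bar>?\<mu> 0\<bar> * (M * q ^ (2 * n)) + ?\<gamma> * S * (M * q ^ (2 * n)) * (1 / (\<rho>\<^sup>2 - 1))"
      unfolding split by (intro order_trans[OF norm_triangle_ineq] add_mono 0)
    also have "\<dots> = ?bound" by (simp only: distrib_left distrib_right mult_ac)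
    finally show ?thesis .
  qed
  have cu: "continuous_on {-1..1} (\<lambda>x. u (complex_of_real x))"
    by (rule continuous_on_focal_segment[OF assms(1,2)])
  \<comment> \<open>Splitting off the truncated expansion leaves an error that is uniformly small on
    the interval; \<open>C\<close> does not depend on L.\<close>
  have "cmod (gauss_remainder \<alpha> n u) \<le> M * (2 / (1 - q) * q ^ (2 * n + 2 * L + 1)) * C + ?bound" for L
  proof -
    let ?N = "2 * n + 2 * L + 1"
    let ?v = "\<lambda>z. \<Sum>k<?N. a k * of_real (poly (chebyshev_T k) (Re z))"
    have cv: "continuous_on {-1..1} (\<lambda>x. ?v (complex_of_real x))" by (simp add: continuous_intros)
    have "cmod (gauss_remainder \<alpha> n (\<lambda>z. u z - ?v z)) \<le> M * (2 / (1 - q) * q ^ ?N) * C"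
      unfolding C_def
    proof (rule gauss_remainder_bound[OF assms(5)])
      show "continuous_on {-1..1} (\<lambda>x. u (complex_of_real x) - ?v (complex_of_real x))"
        by (intro continuous_on_diff cu cv)
      fix x :: real assume "x \<in> {-1<..<1}"
      then obtain t where t: "x = cos t" "sin t > 0" by (rule interval_cosE)
      then have "poly (chebyshev_T k) x = cos (real k * t)" for k by (simp add: chebyshev_T_cos)
      then show "cmod (u (of_real x) - ?v (complex_of_real x)) \<le> M * (2 / (1 - q) * q ^ ?N)"
        using approx[of ?N t] t by simp
    qed
    moreover have "gauss_remainder \<alpha> n (\<lambda>z. u z - ?v z) = gauss_remainder \<alpha> n u - (\<Sum>k<?N. a k * of_real (?R k))"
      by (simp only: gauss_remainder_diff[OF assms(5) cu cv] gauss_remainder_chebyshev_sum[OF assms(5)])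
    ultimately have "cmod (gauss_remainder \<alpha> n u - (\<Sum>k<?N. a k * of_real (?R k))) \<le> M * (2 / (1 - q) * q ^ ?N) * C"
      by (simp only:)
    from add_mono[OF main[of L] this] show ?thesis
      by (intro order_trans[OF norm_triangle_sub]) (simp only: add.commute)
  qed
  \<comment> \<open>Only the truncation error depends on L, and it tends to 0, while
    \<open>?bound\<close> stays fixed.\<close>
  moreover have "(\<lambda>L. M * (2 / (1 - q) * q ^ (2 * n + 2 * L + 1)) * C + ?bound) \<longlonglongrightarrow> M * (2 / (1 - q) * 0) * C + ?bound"
  proof (intro tendsto_intros)
    have "(\<lambda>L. q ^ (2 * n + 1) * (q\<^sup>2) ^ L) \<longlonglongrightarrow> q ^ (2 * n + 1) * 0"
      using q by (intro tendsto_intros LIMSEQ_power_zero) (auto simp: abs_square_less_1)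
    moreover have "q ^ (2 * n + 1) * (q\<^sup>2) ^ L = q ^ (2 * n + 2 * L + 1)" for L
      unfolding power_mult[symmetric] power_add[symmetric] by (simp add: add_ac)
    ultimately show "(\<lambda>L. q ^ (2 * n + 2 * L + 1)) \<longlonglongrightarrow> 0"
      by (simp only: mult_zero_right)
  qed
  ultimately have "cmod (gauss_remainder \<alpha> n u) \<le> M * (2 / (1 - q) * 0) * C + ?bound"
    by (intro LIMSEQ_le_const) auto
  then show "cmod (gauss_remainder \<alpha> n u) \<le> ?\<gamma> * (\<bar>?\<mu> 0\<bar> + (SUP l. \<bar>?\<mu> (l + 1) - ?\<mu> l\<bar>) * (1 / (\<rho>\<^sup>2 - 1))) * (M / \<rho> ^ (2 * n))"
    unfolding S_def[symmetric] by (simp add: q_def power_divide)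
qed

end
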